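(* Let $T_1$ and $T_2$ be trees with orders $m$ and $n$ and diameters $d_1$ and $d_2$, let $G=T_1\Box T_2$, $p=mn$, $d=d_1+d_2$. Then ${\rm rn}(G)$ equals $$ \begin{cases} (p-1)(d+1)-2nL(T_1)-2mL(T_2)+1, & \text{if } |W(T_1)|=|W(T_2)|=1,\\ (p-1)d-2nL(T_1)-2mL(T_2), & \text{if } |W(T_1)|\cdot|W(T_2)|=2,\\ (p-1)(d-1)-2nL(T_1)-2mL(T_2)+1, & \text{if } |W(T_1)|=|W(T_2)|=2, \end{cases} $$ if and only if there exists a feasible ordering $(z_0,\ldots,z_{p-1})$ of $V(G)$ such that: (a) $L(z_0)+L(z_{p-1})=1$ when $|W(G)|=1$, and $L(z_0)+L(z_{p-1})=0$ when $|W(G)|\ge 2$; (b) for all $0\le a<b\le p-1$, $$ d(z_a,z_b)\geq \sum_{t=a}^{b-1}\big[L(z_t)+L(z_{t+1})+\delta(z_t,z_{t+1})\big]-(b-a-1)(d+1).$$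
   Context: All graphs are finite, simple and connected; $d(u,v)$ is the distance and ${\rm diam}(G)$ the diameter. A radio labeling of $G$ is a map $f:V(G)\to\mathbb{Z}_{\ge 0}$ with $|f(u)-f(v)|\geq {\rm diam}(G)+1-d(u,v)$ for all distinct $u,v$; its span is $\max f-\min f$, and ${\rm rn}(G)$ is the minimum span. For a graph $H$ and $v\in V(H)$, $w_H(v)=\sum_{u\in V(H)}d(u,v)$; weight centers minimize $w_H$, and $W(H)$ is their set. A tree $T$ has one or two weight centers, adjacent if two. The level is $L_T(u)=\min_{w\in W(T)}d(u,w)$ and $L(T)=\sum_u L_T(u)$. Root $T$ at its weight center(s): $u$ is an ancestor of $v$ if the unique path from $v$ to its nearest weight center passes through $u$ (every vertex is its own ancestor). $\phi_T(u,v)=\max\{L_T(z): z$ a common ancestor of $u,v\}$ (0 if none). $\delta_T(u,v)=1$ if $W(T)=\{w,w'\}$ and $u,v$ lie in different components of $T-ww'$, else $0$. For $G=T_1\Box T_2$ and $z=(x,y)$: $L(z)=L_{T_1}(x)+L_{T_2}(y)$, $\phi(z_a,z_b)=\phi_{T_1}(x_a,x_b)+\phi_{T_2}(y_a,y_b)$, $\delta(z_a,z_b)=\delta_{T_1}(x_a,x_b)+\delta_{T_2}(y_a,y_b)$. $W(G)=W(T_1)\times W(T_2)$. Let $\xi=|W(T_1)|+|W(T_2)|-2$. Vertices $z_a,z_b$ are feasible if $\phi(z_a,z_b)=0$ and $\delta(z_a,z_b)=\xi$ (different/opposite/separate sectors when $|W(G)|=1/2/4$), non-feasible otherwise. An ordering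 $(z_0,\ldots,z_{p-1})$ of $V(G)$ is feasible if $z_t,z_{t+1}$ are feasible for all $0\le t\le p-2$, except that when $|W(G)|=4$ and $t=p/2-1$ one instead requires $\phi(z_{p/2-1},z_{p/2})=0$ and $\delta(z_{p/2-1},z_{p/2})=1$. *)

theory Defs
  imports "Graph_Theory.Graph_Theory"
begin

text \<open>
  A finite simple graph is a \<^locale>\<open>pair_graph\<close>: finite, loop-free, with a symmetric set of
  arcs.  The constant \<^const>\<open>Digraph_Component.tree\<close> is not usable for such graphs, because both
  orientations of one edge already form a \<open>cycle\<close> of length 2 in the sense of the library.  A cycle
  of the undirected graph is a \<open>cycle\<close> of length at least 3.
\<close>

definition undirected_tree :: "'a pair_pre_digraph \<Rightarrow> bool" where
  "undirected_tree T \<longleftrightarrow>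
     pair_graph T \<and> connected (with_proj T) \<and>
     \<not> (\<exists>p. pre_digraph.cycle (with_proj T) p \<and> 3 \<le> length p)"

text \<open>Distance and diameter are only meaningful for connected finite graphs.\<close>

definition gdist :: "'a pair_pre_digraph \<Rightarrow> 'a \<Rightarrow> 'a \<Rightarrow> nat" where
  "gdist G u v = (LEAST k. \<exists>p. pre_digraph.awalk (with_proj G) u p v \<and> length p = k)"

definition diam :: "'a pair_pre_digraph \<Rightarrow> nat" where
  "diam G = Max {gdist G u v | u v. u \<in> pverts G \<and> v \<in> pverts G}"

definition cart_prod ::
  "'a pair_pre_digraph \<Rightarrow> 'b pair_pre_digraph \<Rightarrow> ('a \<times> 'b) pair_pre_digraph" where
  "cart_prod G H =
     \<lparr> pverts = pverts G \<times> pverts H,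
       parcs = {((x, y), (x', y')) | x y x' y'.
          (x = x' \<and> x \<in> pverts G \<and> (y, y') \<in> parcs H) \<or>
          (y = y' \<and> y \<in> pverts H \<and> (x, x') \<in> parcs G)} \<rparr>"

definition radio_labeling :: "'a pair_pre_digraph \<Rightarrow> ('a \<Rightarrow> nat) \<Rightarrow> bool" where
  "radio_labeling G f \<longleftrightarrow>
     (\<forall>u \<in> pverts G. \<forall>v \<in> pverts G. u \<noteq> v \<longrightarrow>
        \<bar>int (f u) - int (f v)\<bar> \<ge> int (diam G) + 1 - int (gdist G u v))"

definition label_span :: "'a pair_pre_digraph \<Rightarrow> ('a \<Rightarrow> nat) \<Rightarrow> nat" where
  "label_span G f = Max (f ` pverts G) - Min (f ` pverts G)"

definition radio_number :: "'a pair_pre_digraph \<Rightarrow> nat" where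
  "radio_number G = (LEAST k. \<exists>f. radio_labeling G f \<and> label_span G f = k)"

definition vertex_weight :: "'a pair_pre_digraph \<Rightarrow> 'a \<Rightarrow> nat" where
  "vertex_weight H v = (\<Sum>u \<in> pverts H. gdist H u v)"

definition weight_centers :: "'a pair_pre_digraph \<Rightarrow> 'a set" where
  "weight_centers H =
     {v \<in> pverts H. \<forall>u \<in> pverts H. vertex_weight H v \<le> vertex_weight H u}"

definition level :: "'a pair_pre_digraph \<Rightarrow> 'a \<Rightarrow> nat" where
  "level T u = Min (gdist T u ` weight_centers T)"

definition total_level :: "'a pair_pre_digraph \<Rightarrow> nat" where
  "total_level T = (\<Sum>u \<in> pverts T. level T u)"

text \<open>
  In a tree the nearest weight center \<open>w\<close> and the path \<open>p\<close> below are unique, so that it does not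
  matter that they are quantified existentially.
\<close>

definition ancestor :: "'a pair_pre_digraph \<Rightarrow> 'a \<Rightarrow> 'a \<Rightarrow> bool" where
  "ancestor T u v \<longleftrightarrow>
     (\<exists>w \<in> weight_centers T. gdist T v w = level T v \<and>
        (\<exists>p. pre_digraph.apath (with_proj T) v p w \<and>
             u \<in> set (pre_digraph.awalk_verts (with_proj T) v p)))"

definition phi :: "'a pair_pre_digraph \<Rightarrow> 'a \<Rightarrow> 'a \<Rightarrow> nat" where
  "phi T u v =
     (let A = {z \<in> pverts T. ancestor T z u \<and> ancestor T z v}
      in if A = {} then 0 else Max (level T ` A))"

definition remove_edge :: "'a pair_pre_digraph \<Rightarrow> 'a \<Rightarrow> 'a \<Rightarrow> 'a pair_pre_digraph" where
  "remove_edge T w w' = \<lparr> pverts = pverts T, parcs = parcs T - {(w, w'), (w', w)} \<rparr>"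

definition delta :: "'a pair_pre_digraph \<Rightarrow> 'a \<Rightarrow> 'a \<Rightarrow> nat" where
  "delta T u v =
     (if \<exists>w w'. w \<noteq> w' \<and> weight_centers T = {w, w'} \<and>
           \<not> reachable (with_proj (remove_edge T w w')) u v
      then 1 else 0)"

definition prod_level ::
  "'a pair_pre_digraph \<Rightarrow> 'b pair_pre_digraph \<Rightarrow> 'a \<times> 'b \<Rightarrow> nat" where
  "prod_level T1 T2 z = level T1 (fst z) + level T2 (snd z)"

definition prod_phi ::
  "'a pair_pre_digraph \<Rightarrow> 'b pair_pre_digraph \<Rightarrow> 'a \<times> 'b \<Rightarrow> 'a \<times> 'b \<Rightarrow> nat" where
  "prod_phi T1 T2 za zb = phi T1 (fst za) (fst zb) + phi T2 (snd za) (snd zb)"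

definition prod_delta ::
  "'a pair_pre_digraph \<Rightarrow> 'b pair_pre_digraph \<Rightarrow> 'a \<times> 'b \<Rightarrow> 'a \<times> 'b \<Rightarrow> nat" where
  "prod_delta T1 T2 za zb = delta T1 (fst za) (fst zb) + delta T2 (snd za) (snd zb)"

definition xi :: "'a pair_pre_digraph \<Rightarrow> 'b pair_pre_digraph \<Rightarrow> nat" where
  "xi T1 T2 = card (weight_centers T1) + card (weight_centers T2) - 2"

definition feasible_pair ::
  "'a pair_pre_digraph \<Rightarrow> 'b pair_pre_digraph \<Rightarrow> 'a \<times> 'b \<Rightarrow> 'a \<times> 'b \<Rightarrow> bool" where
  "feasible_pair T1 T2 za zb \<longleftrightarrow>
     prod_phi T1 T2 za zb = 0 \<and> prod_delta T1 T2 za zb = xi T1 T2"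

text \<open>
  An ordering of the vertices is a function on indices; only its values below \<open>p\<close> matter.
  When there are four weight centers, \<open>p\<close> is a positive even number, so \<open>p div 2 - 1\<close> is exact.
\<close>

definition feasible_ordering ::
  "'a pair_pre_digraph \<Rightarrow> 'b pair_pre_digraph \<Rightarrow> (nat \<Rightarrow> 'a \<times> 'b) \<Rightarrow> bool" where
  "feasible_ordering T1 T2 z \<longleftrightarrow>
     (let G = cart_prod T1 T2; p = card (pverts G) in
        bij_betw z {..<p} (pverts G) \<and>
        (\<forall>t. t + 1 < p \<longrightarrow>
           (if card (weight_centers G) = 4 \<and> t = p div 2 - 1
            then prod_phi T1 T2 (z t) (z (t + 1)) = 0 \<and> prod_delta T1 T2 (z t) (z (t + 1)) = 1
            else feasible_pair T1 T2 (z t) (z (t + 1)))))"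

end

theory Submission
  imports Defs
begin

text \<open>
  In a tree every edge is a bridge, so distances add up across an edge. Hence weight centers
  are adjacent, there are at most two of them, and
  \<open>d(u,v) = L(u) + L(v) + \<delta>(u,v) - 2\<phi>(u,v)\<close>; all four terms add up over the factors of a
  Cartesian product.

  List the vertices of \<open>G\<close> by increasing label as \<open>z\<^sub>0, \<dots>, z\<^bsub>p-1\<^esub>\<close>. Summing the radio condition over
  consecutive pairs bounds the span from below by
  \<open>(p-1)(d+1-\<xi>) - 2\<Sigma>L + L(z\<^sub>0) + L(z\<^bsub>p-1\<^esub>) + \<Sigma>(\<xi> - \<delta> + 2\<phi>)\<close>, where the part after \<open>2\<Sigma>L\<close>
  is, for \<open>p \<ge> 2\<close>, at least 1, 0, 1 when \<open>|W(G)|\<close> is 1, 2, 4. The bound is attained iff that part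
  is minimal and all consecutive radio conditions are tight; tight labels satisfy the remaining
  radio conditions iff (b) holds. When \<open>|W(G)| = 4\<close>, a step with \<open>\<delta> = 2\<close> stays inside a pair of
  opposite sectors, which holds half of the vertices. So at least one step has \<open>\<delta> < 2\<close>, and a
  single such step occurs exactly in the middle of the ordering.
\<close>

section \<open>Distances in connected graphs\<close>

locale conn_graph = pair_graph +
  assumes connected: "connected (with_proj G)"
begin

lemma walk_exists:
  assumes "u \<in> pverts G" "v \<in> pverts G"
  shows "\<exists>p. awalk u p v"
proof -
  have "strongly_connected (with_proj G)"
    using symmetric_connected_imp_strongly_connected sym_arcs connected by blast
  then have "reachable (with_proj G) u v"
    using assms by (auto simp: strongly_connected_def)
  then show ?thesis by (simp add: reachable_awalk)
qed

lemma pverts_nonempty: "pverts G \<noteq> {}"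
  using connected by (auto simp: connected_def strongly_connected_def)

lemma gdist_le_length: "awalk u p v \<Longrightarrow> gdist G u v \<le> length p"
  unfolding gdist_def by (rule Least_le) blast

lemma shortest_walk:
  assumes "u \<in> pverts G" "v \<in> pverts G"
  obtains p where "awalk u p v" "length p = gdist G u v"
proof -
  have "\<exists>k p. awalk u p v \<and> length p = k" using walk_exists[OF assms] by blast
  from LeastI_ex[OF this] show ?thesis using that unfolding gdist_def by blast
qed

text \<open>A function that grows by at most 1 along every arc bounds walk lengths from below. For
  the product this replaces splitting walks into their projections.\<close>

lemma potential_le_length:
  fixes f :: "'a \<Rightarrow> nat"
  assumes "\<And>x y. (x, y) \<in> parcs G \<Longrightarrow> f y \<le> f x + 1" and "awalk u p v"
  shows "f v \<le> f u + length p"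
  using assms(2)
proof (induction p arbitrary: u)
  case Nil
  then show ?case by (simp add: awalk_Nil_iff)
next
  case (Cons e p)
  obtain x y where e: "e = (x, y)" by (cases e)
  with Cons.prems have "u = x" "(x, y) \<in> parcs G" "awalk y p v" by (auto simp: awalk_Cons_iff)
  with Cons.IH[of y] assms(1)[of x y] show ?case by simp
qed

lemma potential_le_gdist:
  fixes f :: "'a \<Rightarrow> nat"
  assumes "\<And>x y. (x, y) \<in> parcs G \<Longrightarrow> f y \<le> f x + 1"
    and "u \<in> pverts G" "v \<in> pverts G"
  shows "f v \<le> f u + gdist G u v"
  by (metis assms potential_le_length shortest_walk)

lemma gdist_self [simp]: "u \<in> pverts G \<Longrightarrow> gdist G u u = 0"
  using gdist_le_length[of u "[]" u] by (simp add: awalk_Nil_iff)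

lemma gdist_eq_0_iff [simp]:
  assumes "u \<in> pverts G" "v \<in> pverts G"
  shows "gdist G u v = 0 \<longleftrightarrow> u = v"
proof
  assume "gdist G u v = 0"
  then obtain p where "awalk u p v" "length p = 0" using shortest_walk[OF assms] by metis
  then show "u = v" by (simp add: awalk_Nil_iff)
qed (use assms in simp)

lemma gdist_commute:
  assumes "u \<in> pverts G" "v \<in> pverts G"
  shows "gdist G u v = gdist G v u"
proof -
  have len: "length (rev_path p) = length p" for p :: "('a \<times> 'a) list" by (induction p) auto
  have "gdist G y x \<le> gdist G x y" if xy: "x \<in> pverts G" "y \<in> pverts G" for x y
  proof -
    obtain p where "awalk x p y" "length p = gdist G x y" using shortest_walk[OF xy] .
    then show ?thesis using gdist_le_length[of y "rev_path p" x] by (simp add: len)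
  qed
  then show ?thesis using assms by (metis le_antisym)
qed

lemma gdist_triangle:
  assumes "u \<in> pverts G" "v \<in> pverts G" "w \<in> pverts G"
  shows "gdist G u w \<le> gdist G u v + gdist G v w"
proof -
  obtain p where p: "awalk u p v" "length p = gdist G u v" using shortest_walk assms by metis
  obtain q where q: "awalk v q w" "length q = gdist G v w" using shortest_walk assms by metis
  have "awalk u (p @ q) w" using p q by (blast intro: awalk_appendI)
  from gdist_le_length[OF this] show ?thesis using p q by simp
qed

lemma gdist_arc: 
  assumes "(u, v) \<in> parcs G" shows "gdist G u v = 1"
proof -
  have V: "u \<in> pverts G" "v \<in> pverts G" using assms by (auto dest: wellformed')
  have "gdist G u v \<le> 1" using gdist_le_length[of u "[(u, v)]" v] assms V
    by (simp add: awalk_simps)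
  moreover have "gdist G u v \<noteq> 0" using V assms no_loops' by auto
  ultimately show ?thesis by simp
qed

text \<open>The tail of a shortest walk is itself shortest.\<close>

lemma gdist_step:
  assumes "u \<in> pverts G" "v \<in> pverts G" "u \<noteq> v"
  obtains u' where "(u, u') \<in> parcs G" "gdist G u v = Suc (gdist G u' v)"
proof -
  obtain p where p: "awalk u p v" "length p = gdist G u v" using shortest_walk assms by metis
  with assms(3) obtain e q where "p = e # q" by (cases p) (auto simp: awalk_Nil_iff)
  then obtain x where x: "p = (u, x) # q" "(u, x) \<in> parcs G" "awalk x q v"
    using p by (cases e) (auto simp: awalk_Cons_iff)
  have "gdist G x v \<le> length q" using gdist_le_length x by blast
  moreover have "gdist G u v \<le> 1 + gdist G x v"
    using gdist_triangle[of u x v] gdist_arc[OF x(2)] assms x(2) by (auto dest: wellformed')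
  ultimately have "gdist G u v = Suc (gdist G x v)" using p x by simp
  with x that show ?thesis by blast
qed

lemma gdist_le_diam:
  assumes "u \<in> pverts G" "v \<in> pverts G"
  shows "gdist G u v \<le> diam G"
proof -
  have "{gdist G u v | u v. u \<in> pverts G \<and> v \<in> pverts G}
    = (\<lambda>(u, v). gdist G u v) ` (pverts G \<times> pverts G)" by auto
  then show ?thesis unfolding diam_def by (intro Max_ge) (use assms in auto)
qed

lemma diam_attained:
  obtains u v where "u \<in> pverts G" "v \<in> pverts G" "gdist G u v = diam G"
proof -
  have eq: "{gdist G u v | u v. u \<in> pverts G \<and> v \<in> pverts G}
    = (\<lambda>(u, v). gdist G u v) ` (pverts G \<times> pverts G)" by auto
  have "diam G \<in> {gdist G u v | u v. u \<in> pverts G \<and> v \<in> pverts G}"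
    unfolding diam_def by (intro Max_in) (use pverts_nonempty in \<open>auto simp: eq\<close>)
  then show ?thesis using that by auto
qed

end


section \<open>Trees\<close>

lemma remove_edge_simps [simp]:
  "pverts (remove_edge G a b) = pverts G"
  "parcs (remove_edge G a b) = parcs G - {(a, b), (b, a)}"
  by (simp_all add: remove_edge_def)

section \<open>Walks and deletion of an edge\<close>

context pair_graph
begin

lemma awalk_split_arc:
  assumes "awalk u (q @ (x, y) # r) v"
  shows "awalk u q x" "awalk y r v"
proof -
  have "cas u q x \<and> cas y r v" using assms by (simp add: awalk_def)
  then show "awalk u q x" "awalk y r v"
    using assms by (auto simp: awalk_def dest: wellformed')
qed

lemma pair_graph_remove_edge: "pair_graph (remove_edge G a b)"
proof
  show "symmetric (with_proj (remove_edge G a b))"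
    unfolding symmetric_def
    by (rule symI) (auto intro: arcs_symmetric)
  show "finite (parcs (remove_edge G a b))"
    by simp
qed (auto dest: wellformed' no_loops')

lemma reachable_remove_edge_sym:
  "reachable (with_proj (remove_edge G a b)) u v \<Longrightarrow> reachable (with_proj (remove_edge G a b)) v u"
  by (meson pair_graph_remove_edge pair_graph.axioms pair_pseudo_graph.axioms
      pair_sym_digraph.pair_sym_arcs pair_sym_digraph_def pair_graph_def pair_pseudo_graph_def symmetric_reachable)

lemma reachable_remove_edge_trans:
  "reachable (with_proj (remove_edge G a b)) u v \<Longrightarrow> reachable (with_proj (remove_edge G a b)) v w \<Longrightarrow>
   reachable (with_proj (remove_edge G a b)) u w"
  unfolding reachable_def by (rule rtrancl_on_trans)

lemma remove_edge_commute: "remove_edge G a b = remove_edge G b a"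
  by (auto simp: remove_edge_def)

lemma walk_remove_edge:
  assumes "awalk u p v" "(a, b) \<notin> set p" "(b, a) \<notin> set p"
  shows "reachable (with_proj (remove_edge G a b)) u v"
proof -
  interpret R: pair_graph "remove_edge G a b" by (rule pair_graph_remove_edge)
  have "R.awalk u p v" using assms
    by (auto simp: awalk_def R.awalk_def)
  then show ?thesis by (rule R.reachable_awalkI)
qed

end

section \<open>Edges of a tree as bridges\<close>

locale tree_graph = conn_graph +
  assumes acyclic: "cycle p \<Longrightarrow> length p < 3"
begin

lemma bridge:
  assumes ab: "(a, b) \<in> parcs G"
  shows "\<not> reachable (with_proj (remove_edge G a b)) a b"
proof
  interpret R: pair_graph "remove_edge G a b" by (rule pair_graph_remove_edge)
  assume "reachable (with_proj (remove_edge G a b)) a b"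
  then obtain p where "R.apath a p b" by (auto simp: R.reachable_apath)
  then have p: "awalk a p b" "distinct (awalk_verts a p)" "(a, b) \<notin> set p"
    by (auto simp: R.apath_def awalk_def R.awalk_def)
  \<comment> \<open>Closing the path with the arc from \<open>b\<close> to \<open>a\<close> gives a cycle; it is too long to be a pair of opposite arcs.\<close>
  have "awalk b ((b, a) # p) b" using p ab arcs_symmetric by (auto simp: awalk_Cons_iff)
  with p have "cycle ((b, a) # p)" by (auto simp: cycle_def intro!: exI[of _ b])
  then have "length p < 2" using acyclic by fastforce
  moreover have "p \<noteq> []" using p ab no_loops' by (auto simp: awalk_Nil_iff)
  ultimately obtain e where "p = [e]" by (cases p) (auto simp: less_Suc_eq)
  with p show False by (cases e) (auto simp: awalk_simps)
qed

lemma reachable_nearer_end: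
  assumes ab: "(a, b) \<in> parcs G" and u: "u \<in> pverts G" and le: "gdist G u a \<le> gdist G u b"
  shows "reachable (with_proj (remove_edge G a b)) u a"
proof -
  have V: "a \<in> pverts G" "b \<in> pverts G" using ab by (auto dest: wellformed')
  obtain p where p: "awalk u p a" "length p = gdist G u a" using shortest_walk[OF u V(1)] .
  have "(a, b) \<notin> set p"
  proof
    assume "(a, b) \<in> set p"
    then obtain q r where qr: "p = q @ (a, b) # r" by (auto simp: in_set_conv_decomp)
    with p have "awalk u q a" by (blast dest: awalk_split_arc)
    from gdist_le_length[OF this] show False using p qr by simp
  qed
  moreover have "(b, a) \<notin> set p"
  proof
    assume "(b, a) \<in> set p"
    then obtain q r where qr: "p = q @ (b, a) # r" by (auto simp: in_set_conv_decomp)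
    with p have "awalk u q b" by (blast dest: awalk_split_arc)
    from gdist_le_length[OF this] show False using p qr le by simp
  qed
  ultimately show ?thesis using walk_remove_edge p by blast
qed

text \<open>Trees are bipartite: in a tie both ends stay reachable from \<open>u\<close> once the
  edge is gone, and then the edge is no bridge.\<close>

lemma gdist_ends_neq:
  assumes ab: "(a, b) \<in> parcs G" and u: "u \<in> pverts G"
  shows "gdist G u a \<noteq> gdist G u b"
proof
  assume eq: "gdist G u a = gdist G u b"
  have "reachable (with_proj (remove_edge G a b)) u a"
    using reachable_nearer_end[OF ab u] eq by simp
  moreover have "reachable (with_proj (remove_edge G a b)) u b"
    using reachable_nearer_end[of b a u] ab u eq arcs_symmetric remove_edge_commute by simp
  ultimately show False
    using bridge[OF ab] reachable_remove_edge_sym reachable_remove_edge_trans by blast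
qed

lemma gdist_ends_cases:
  assumes ab: "(a, b) \<in> parcs G" and u: "u \<in> pverts G"
  shows "gdist G u b = Suc (gdist G u a) \<or> gdist G u a = Suc (gdist G u b)"
proof -
  have V: "a \<in> pverts G" "b \<in> pverts G" using ab by (auto dest: wellformed')
  have "gdist G a b = 1" "gdist G b a = 1" using ab arcs_symmetric gdist_arc by auto
  then show ?thesis
    using gdist_ends_neq[OF ab u] gdist_triangle[OF u V] gdist_triangle[OF u V(2,1)] by linarith
qed

text \<open>Turns membership in a component of the tree minus an edge into a comparison of
  distances, the form in which sides of an edge are handled below.\<close>

lemma reachable_end_iff:
  assumes ab: "(a, b) \<in> parcs G" and u: "u \<in> pverts G"
  shows "reachable (with_proj (remove_edge G a b)) u a \<longleftrightarrow> gdist G u a < gdist G u b"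
proof
  assume r: "reachable (with_proj (remove_edge G a b)) u a"
  show "gdist G u a < gdist G u b"
  proof (rule ccontr)
    assume "\<not> ?thesis"
    then have "reachable (with_proj (remove_edge G a b)) u b"
      using reachable_nearer_end[of b a u] ab u arcs_symmetric remove_edge_commute by simp
    with r show False using bridge[OF ab] reachable_remove_edge_sym reachable_remove_edge_trans by blast
  qed
qed (use reachable_nearer_end[OF ab u] in simp)

text \<open>Every walk between the two sides passes through the bridge, and cutting it there leaves
  two walks that are at least as long as the distances.\<close>

lemma gdist_across:
  assumes ab: "(a, b) \<in> parcs G" and u: "u \<in> pverts G" "gdist G u a < gdist G u b"
    and v: "v \<in> pverts G" "gdist G v b < gdist G v a"
  shows "gdist G u v = gdist G u a + 1 + gdist G b v"
proof (rule antisym)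
  have V: "a \<in> pverts G" "b \<in> pverts G" using ab by (auto dest: wellformed')
  show "gdist G u v \<le> gdist G u a + 1 + gdist G b v"
    using gdist_triangle[OF u(1) V(1) v(1)] gdist_triangle[OF V(1,2) v(1)] gdist_arc[OF ab] by simp
  obtain p where p: "awalk u p v" "length p = gdist G u v" using shortest_walk[OF u(1) v(1)] .
  have ba: "(b, a) \<in> parcs G" using ab arcs_symmetric by blast
  consider "(a, b) \<in> set p" | "(b, a) \<in> set p" | "(a, b) \<notin> set p" "(b, a) \<notin> set p" by blast
  then show "gdist G u a + 1 + gdist G b v \<le> gdist G u v"
  proof cases
    case 1
    then obtain q r where qr: "p = q @ (a, b) # r" by (auto simp: in_set_conv_decomp)
    with p have "awalk u q a" "awalk b r v" by (blast dest: awalk_split_arc)+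
    from this[THEN gdist_le_length] p qr show ?thesis by simp
  next
    \<comment> \<open>Backwards use of the edge is even longer: each of the two pieces joins an
      endpoint of the walk to its farther end of the edge.\<close>
    case 2
    then obtain q r where qr: "p = q @ (b, a) # r" by (auto simp: in_set_conv_decomp)
    with p have "awalk u q b" "awalk a r v" by (blast dest: awalk_split_arc)+
    from this[THEN gdist_le_length] p qr u v show ?thesis
      using gdist_commute[OF V(2) v(1)] gdist_commute[OF V(1) v(1)] by simp
  next
    \<comment> \<open>A walk that avoids the edge would reconnect \<open>a\<close> to
      \<open>b\<close> after its deletion.\<close>
    case 3
    have "reachable (with_proj (remove_edge G a b)) u a"
      using reachable_end_iff[OF ab] u by blast
    moreover have "reachable (with_proj (remove_edge G a b)) v b"
      using reachable_end_iff[OF ba] v remove_edge_commute[of a b] by simp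
    moreover have "reachable (with_proj (remove_edge G a b)) u v"
      using walk_remove_edge p 3 by blast
    ultimately show ?thesis
      using bridge[OF ab] reachable_remove_edge_sym reachable_remove_edge_trans by blast
  qed
qed

text \<open>Induction along the path: its rest never returns to \<open>v\<close>, so it avoids the
  edge from \<open>v\<close> to \<open>b\<close> in both directions. This puts \<open>w\<close> on
  the side of \<open>b\<close>, and the first step gets one closer to \<open>w\<close>.\<close>

lemma apath_length: "apath v p w \<Longrightarrow> length p = gdist G v w"
proof (induction p arbitrary: v)
  case Nil
  then show ?case by (auto simp: apath_Nil_iff)
next
  case (Cons e q)
  obtain b where e: "e = (v, b)" and vb: "(v, b) \<in> parcs G" and q: "apath b q w"
    and notin: "v \<notin> set (awalk_verts b q)"
    using Cons.prems by (cases e) (auto simp: apath_Cons_iff)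
  have w: "w \<in> pverts G" and V: "v \<in> pverts G" "b \<in> pverts G" and wq: "awalk b q w"
    using q vb by (auto simp: apath_def dest: awalk_last_in_verts wellformed')
  have "x \<in> set (awalk_verts b q)" "y \<in> set (awalk_verts b q)" if "(x, y) \<in> set q" for x y
    using that awalk_verts_arc1[of "(x, y)" q b] awalk_verts_arc2[of b q w "(x, y)"] wq
    by (auto simp: awalk_def)
  then have "(v, b) \<notin> set q" "(b, v) \<notin> set q" using notin by blast+
  then have "reachable (with_proj (remove_edge G b v)) w b"
    using walk_remove_edge[OF wq] reachable_remove_edge_sym by blast
  then have "gdist G w b < gdist G w v"
    using reachable_end_iff[of b v w] vb arcs_symmetric w by blast
  then have "gdist G v w = Suc (gdist G b w)"
    using gdist_ends_cases[OF vb w] gdist_commute w V by auto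
  then show ?case using Cons.IH[OF q] e by simp
qed

text \<open>A walk that came back to its start could be shortened, so shortest walks repeat no
  vertex. With the previous lemma, paths and shortest walks coincide.\<close>

lemma shortest_walk_apath: "awalk v p w \<Longrightarrow> length p = gdist G v w \<Longrightarrow> apath v p w"
proof (induction p arbitrary: v)
  case Nil
  then show ?case by (auto simp: awalk_Nil_iff apath_Nil_iff)
next
  case (Cons e q)
  obtain b where e: "e = (v, b)" and vb: "(v, b) \<in> parcs G" and q: "awalk b q w"
    using Cons.prems by (cases e) (auto simp: awalk_Cons_iff)
  have V: "v \<in> pverts G" "b \<in> pverts G" "w \<in> pverts G" 
    using q vb by (auto dest: awalk_last_in_verts wellformed')
  have "length q = gdist G b w"
    using gdist_triangle[OF V] gdist_arc[OF vb] Cons.prems gdist_le_length[OF q] by simp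
  then have "apath b q w" using Cons.IH[OF q] by blast
  moreover have "v \<notin> set (awalk_verts b q)"
  proof
    assume "v \<in> set (awalk_verts b q)"
    then obtain r s where "q = r @ s" "awalk v s w" using awalk_decomp[OF q] by blast
    then show False using gdist_le_length[of v s w] Cons.prems by simp
  qed
  ultimately show ?case using e vb by (simp add: apath_Cons_iff)
qed

text \<open>Replaces the paths in the definition of ancestors by distance equations; from here on,
  ancestors are points of geodesic intervals.\<close>

lemma on_apath_iff:
  assumes "v \<in> pverts G" "w \<in> pverts G"
  shows "(\<exists>p. apath v p w \<and> z \<in> set (awalk_verts v p)) \<longleftrightarrow>
    z \<in> pverts G \<and> gdist G v z + gdist G z w = gdist G v w"
proof safe
  fix p assume p: "apath v p w" and z: "z \<in> set (awalk_verts v p)"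
  then have aw: "awalk v p w" by (simp add: apath_def)
  obtain q r where qr: "p = q @ r" "awalk v q z" "awalk z r w" using awalk_decomp[OF aw z] by blast
  show zV: "z \<in> pverts G" by (rule awalk_last_in_verts[OF qr(2)])
  show "gdist G v z + gdist G z w = gdist G v w"
    using apath_length[OF p] qr(1) gdist_le_length[OF qr(2)] gdist_le_length[OF qr(3)]
      gdist_triangle[OF assms(1) zV assms(2)] by simp
next
  assume z: "z \<in> pverts G" and eq: "gdist G v z + gdist G z w = gdist G v w"
  obtain q where q: "awalk v q z" "length q = gdist G v z" using shortest_walk[OF assms(1) z] .
  obtain r where r: "awalk z r w" "length r = gdist G z w" using shortest_walk[OF z assms(2)] .
  have "awalk v (q @ r) w" using q r by (blast intro: awalk_appendI)
  moreover from this have "apath v (q @ r) w" using q r eq by (intro shortest_walk_apath) auto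
  moreover have "z \<in> set (awalk_verts v (q @ r))"
    using q r set_awalk_verts_append[of v q z r w] hd_in_awalk_verts by auto
  ultimately show "\<exists>p. apath v p w \<and> z \<in> set (awalk_verts v p)" by blast
qed

end

lemma tree_graphI:
  assumes "undirected_tree T"
  shows "tree_graph T"
proof -
  interpret pair_graph T using assms by (simp add: undirected_tree_def)
  show ?thesis
    by unfold_locales (use assms in \<open>auto simp: undirected_tree_def not_le\<close>)
qed


section \<open>Weight centers\<close>

context conn_graph
begin

lemma weight_centers_nonempty: "weight_centers G \<noteq> {}"
proof -
  obtain v where "v \<in> pverts G" "\<And>u. u \<in> pverts G \<Longrightarrow> vertex_weight G v \<le> vertex_weight G u"
    using arg_min_if_finite(1)[OF finite_verts pverts_nonempty, of "vertex_weight G"]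
      arg_min_least[OF finite_verts pverts_nonempty, of _ "vertex_weight G"] by blast
  then show ?thesis by (auto simp: weight_centers_def)
qed

lemma weight_centers_subset: "weight_centers G \<subseteq> pverts G"
  by (auto simp: weight_centers_def)

lemma finite_weight_centers: "finite (weight_centers G)"
  using weight_centers_subset finite_verts by (rule finite_subset)

lemma level_le: "w \<in> weight_centers G \<Longrightarrow> level G u \<le> gdist G u w"
  unfolding level_def using finite_weight_centers by (intro Min_le) auto

lemma level_attained:
  obtains w where "w \<in> weight_centers G" "level G u = gdist G u w"
proof -
  have "level G u \<in> gdist G u ` weight_centers G"
    unfolding level_def using finite_weight_centers weight_centers_nonempty by (intro Min_in) auto
  then show ?thesis using that by auto
qed

lemma level_eq_0_iff:
  assumes "u \<in> pverts G"
  shows "level G u = 0 \<longleftrightarrow> u \<in> weight_centers G"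
proof
  assume "level G u = 0"
  then obtain w where "w \<in> weight_centers G" "gdist G u w = 0" using level_attained by metis
  with assms weight_centers_subset show "u \<in> weight_centers G" by auto
next
  assume "u \<in> weight_centers G"
  from level_le[OF this, of u] assms show "level G u = 0" by simp
qed

end

text \<open>For adjacent \<open>a\<close> and \<open>b\<close> in a tree, this is the component of
  \<open>a\<close> after deletion of the edge between them.\<close>

definition near :: "'a pair_pre_digraph \<Rightarrow> 'a \<Rightarrow> 'a \<Rightarrow> 'a set" where
  "near T a b = {u \<in> pverts T. gdist T u a < gdist T u b}"

context tree_graph
begin

lemma near_disjoint: "near G a b \<inter> near G b a = {}"
  by (auto simp: near_def)

lemma near_Un: "(a, b) \<in> parcs G \<Longrightarrow> near G a b \<union> near G b a = pverts G"
  using gdist_ends_neq by (fastforce simp: near_def)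

lemma finite_near: "finite (near G a b)"
  using finite_verts by (simp add: near_def)

text \<open>Moving from \<open>a\<close> to \<open>b\<close> lengthens the distance by 1 for
  vertices on the side of \<open>a\<close> and shortens it by 1 for all others.\<close>

lemma vertex_weight_arc:
  assumes ab: "(a, b) \<in> parcs G"
  shows "vertex_weight G b + card (near G b a) = vertex_weight G a + card (near G a b)"
proof -
  have card: "card (near G x y) = (\<Sum>u\<in>pverts G. if gdist G u x < gdist G u y then 1 else 0)" for x y
    using finite_verts by (simp add: near_def sum.If_cases Int_def)
  show ?thesis
    unfolding card vertex_weight_def sum.distrib[symmetric]
    by (rule sum.cong) (use gdist_ends_cases[OF ab] in fastforce)+
qed

text \<open>Otherwise moving to \<open>b\<close> would lower the weight.\<close>

lemma center_near_card:
  assumes "a \<in> weight_centers G" "(a, b) \<in> parcs G"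
  shows "card (near G b a) \<le> card (near G a b)"
proof -
  have "vertex_weight G a \<le> vertex_weight G b"
    using assms by (auto simp: weight_centers_def dest: wellformed')
  with vertex_weight_arc[OF assms(2)] show ?thesis by linarith
qed

lemma card_near_add:
  assumes "(a, b) \<in> parcs G"
  shows "card (near G a b) + card (near G b a) = card (pverts G)"
  using card_Un_disjoint[OF finite_near finite_near near_disjoint] near_Un[OF assms] by metis

text \<open>
  If \<open>x\<close> and \<open>y\<close> are the neighbours of \<open>a\<close> and \<open>c\<close> on the path between them, at least half of the
  vertices are nearer to \<open>a\<close> than to \<open>x\<close>, and at least half nearer to \<open>c\<close> than to \<open>y\<close>. These sets
  are disjoint, and miss \<open>x\<close> unless \<open>x = c\<close>.
\<close>

lemma weight_centers_adjacent:
  assumes a: "a \<in> weight_centers G" and c: "c \<in> weight_centers G" and neq: "a \<noteq> c"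
  shows "(a, c) \<in> parcs G"
proof (rule ccontr)
  assume nadj: "(a, c) \<notin> parcs G"
  have V: "a \<in> pverts G" "c \<in> pverts G" using a c weight_centers_subset by auto
  obtain x where x: "(a, x) \<in> parcs G" "gdist G a c = Suc (gdist G x c)"
    using gdist_step[OF V neq] .
  obtain y where y: "(c, y) \<in> parcs G" "gdist G c a = Suc (gdist G y a)"
    using gdist_step[OF V(2,1)] neq by metis
  have W: "x \<in> pverts G" "y \<in> pverts G" using x y by (auto dest: wellformed')
  have "x \<noteq> c" using x nadj by auto
  then have xc: "gdist G x c \<noteq> 0" using W V by simp
  \<comment> \<open>A common vertex would lie across both edges: its distance to \<open>c\<close>
    would exceed its distance to \<open>a\<close>, and the other way round.\<close>
  have "near G a x \<inter> near G c y = {}"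
  proof (rule ccontr)
    assume "\<not> ?thesis"
    then obtain u where u: "u \<in> pverts G" "gdist G u a < gdist G u x" "gdist G u c < gdist G u y"
      by (auto simp: near_def)
    have "gdist G u c = gdist G u a + 1 + gdist G x c"
      by (rule gdist_across[OF x(1)])
        (use u V W x gdist_commute[of c a] gdist_commute[of c x] in auto)
    moreover have "gdist G u a = gdist G u c + 1 + gdist G y a"
      by (rule gdist_across[OF y(1)])
        (use u V W y gdist_commute[of a c] gdist_commute[of a y] in auto)
    ultimately show False by simp
  qed
  moreover have "x \<notin> near G a x" using W by (simp add: near_def)
  moreover have "x \<notin> near G c y"
  proof
    assume xn: "x \<in> near G c y"
    have "gdist G x a = gdist G x c + 1 + gdist G y a"
      by (rule gdist_across[OF y(1)])
        (use xn V W y gdist_commute[of a c] gdist_commute[of a y] in \<open>auto simp: near_def\<close>)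
    moreover have "gdist G x a = 1" using gdist_arc x(1) arcs_symmetric by blast
    ultimately show False using xc by simp
  qed
  ultimately have "card (near G a x) + card (near G c y) + 1 = card (insert x (near G a x \<union> near G c y))"
    by (simp add: card_Un_disjoint finite_near)
  also have "\<dots> \<le> card (pverts G)"
    by (rule card_mono) (use finite_verts W in \<open>auto simp: near_def\<close>)
  finally show False
    using center_near_card[OF a x(1)] center_near_card[OF c y(1)]
      card_near_add[OF x(1)] card_near_add[OF y(1)] by linarith
qed

text \<open>The third vertex would have distance 1 to both ends of an edge, a tie.\<close>

lemma no_triangle:
  assumes "(a, b) \<in> parcs G" "(b, c) \<in> parcs G" shows "(a, c) \<notin> parcs G"
  using assms gdist_ends_neq[of a b c] gdist_arc arcs_symmetric 
  by (metis in_arcsD2)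

text \<open>Centers are pairwise adjacent, so a third one would close a triangle. With two centers
  the weight comparison holds in both directions, so the edge between them halves the vertex set;
  \<open>parity_class\<close> relies on this balance.\<close>

lemma weight_centers_cases:
  obtains (one) w where "w \<in> pverts G" "weight_centers G = {w}"
  | (two) a b where "(a, b) \<in> parcs G" "weight_centers G = {a, b}" "card (near G a b) = card (near G b a)"
proof -
  obtain w where w: "w \<in> weight_centers G" using weight_centers_nonempty by auto
  show thesis
  proof (cases "weight_centers G = {w}")
    case True
    then show ?thesis using one w weight_centers_subset by blast
  next
    case False
    then obtain b where b: "b \<in> weight_centers G" "b \<noteq> w" using w by blast
    have wb: "(w, b) \<in> parcs G" "(b, w) \<in> parcs G" using weight_centers_adjacent w b by auto
    have "c \<in> {w, b}" if "c \<in> weight_centers G" for c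
      using weight_centers_adjacent[OF w that] weight_centers_adjacent[OF b(1) that] no_triangle wb
      by blast
    then have "weight_centers G = {w, b}" using w b by blast
    moreover have "card (near G w b) = card (near G b w)"
      using center_near_card[OF w wb(1)] center_near_card[OF b(1) wb(2)] by simp
    ultimately show ?thesis using two wb by blast
  qed
qed

lemma card_weight_centers: "card (weight_centers G) = 1 \<or> card (weight_centers G) = 2"
  by (cases rule: weight_centers_cases) (auto dest: no_loops')

section \<open>Opposite sides of the center edge\<close>

lemma delta_le_1: "delta G u v \<le> 1"
  by (simp add: delta_def)

lemma delta_one_center: "weight_centers G = {w} \<Longrightarrow> delta G u v = 0"
  by (auto simp: delta_def)

text \<open>Unites delta 0 with one center and delta at most 1 with two centers; summed over the
  factors it becomes \<open>prod_delta_le_xi\<close>.\<close>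

lemma delta_less_card: "delta G u v < card (weight_centers G)"
proof (cases rule: weight_centers_cases)
  case (one w)
  then show ?thesis by (simp add: delta_one_center)
next
  case (two a b)
  then have "a \<noteq> b" using no_loops' by blast
  then show ?thesis using two delta_le_1[of u v] by simp
qed

lemma reachable_remove_edge_iff:
  assumes ab: "(a, b) \<in> parcs G" and V: "u \<in> pverts G" "v \<in> pverts G"
  shows "reachable (with_proj (remove_edge G a b)) u v \<longleftrightarrow> (u \<in> near G a b \<longleftrightarrow> v \<in> near G a b)"
proof -
  have ba: "(b, a) \<in> parcs G" using ab arcs_symmetric by blast
  have A: "reachable (with_proj (remove_edge G a b)) x a \<longleftrightarrow> x \<in> near G a b" if "x \<in> pverts G" for x
    using reachable_end_iff[OF ab that] that by (simp add: near_def)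
  have B: "reachable (with_proj (remove_edge G a b)) x b \<longleftrightarrow> x \<notin> near G a b" if "x \<in> pverts G" for x
    using reachable_end_iff[OF ba that] that near_disjoint[of a b] near_Un[OF ab] remove_edge_commute[of a b]
    by (auto simp: near_def)
  show ?thesis
    using A[OF V(1)] A[OF V(2)] B[OF V(1)] B[OF V(2)]
      reachable_remove_edge_sym reachable_remove_edge_trans by blast
qed

lemma delta_two_centers:
  assumes ab: "(a, b) \<in> parcs G" "weight_centers G = {a, b}" and V: "u \<in> pverts G" "v \<in> pverts G"
  shows "delta G u v = (if u \<in> near G a b \<longleftrightarrow> v \<in> near G a b then 0 else 1)"
proof -
  have neq: "a \<noteq> b" using ab no_loops' by blast
  have "(\<exists>w w'. w \<noteq> w' \<and> weight_centers G = {w, w'} \<and>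
           \<not> reachable (with_proj (remove_edge G w w')) u v) \<longleftrightarrow>
     \<not> reachable (with_proj (remove_edge G a b)) u v" (is "?L \<longleftrightarrow> ?R")
  proof
    assume ?L
    then obtain w w' where "{a, b} = {w, w'}" "\<not> reachable (with_proj (remove_edge G w w')) u v"
      using ab by auto
    \<comment> \<open>\<open>w\<close> and \<open>w'\<close> may be the centers in either order, but
      both orders delete the same edge.\<close>
    then show ?R by (auto simp: doubleton_eq_iff remove_edge_commute)
  next
    assume ?R
    then show ?L using neq ab by blast
  qed
  then show ?thesis unfolding delta_def using reachable_remove_edge_iff[OF ab(1) V] by simp
qed

section \<open>Medians and the distance formula\<close>

lemma median:
  assumes "u \<in> pverts G" "v \<in> pverts G" "w \<in> pverts G"
  obtains z where "z \<in> pverts G" "gdist G u z + gdist G z w = gdist G u w"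
    "gdist G v z + gdist G z w = gdist G v w" "gdist G u z + gdist G z v = gdist G u v"
proof -
  \<comment> \<open>The median is the vertex common to both geodesics towards \<open>w\<close> that is farthest from \<open>w\<close>.\<close>
  define A where "A = {z \<in> pverts G. gdist G u z + gdist G z w = gdist G u w \<and>
    gdist G v z + gdist G z w = gdist G v w}"
  have fin: "finite A" using finite_verts by (simp add: A_def)
  have "w \<in> A" using assms by (simp add: A_def)
  then have "Max ((\<lambda>z. gdist G z w) ` A) \<in> (\<lambda>z. gdist G z w) ` A" using fin by (intro Max_in) auto
  then obtain z where z: "z \<in> A" and "gdist G z w = Max ((\<lambda>z. gdist G z w) ` A)" by auto
  then have zmax: "gdist G x w \<le> gdist G z w" if "x \<in> A" for x
    using that fin by simp
  have zV: "z \<in> pverts G" and zu: "gdist G u z + gdist G z w = gdist G u w"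
    and zv: "gdist G v z + gdist G z w = gdist G v w" using z by (auto simp: A_def)
  have "gdist G u z + gdist G z v = gdist G u v"
  proof (cases "z = u")
    case True
    then show ?thesis using assms by simp
  next
    case False
    obtain x where x: "(z, x) \<in> parcs G" "gdist G z u = Suc (gdist G x u)"
      using gdist_step[OF zV assms(1) False] .
    have xV: "x \<in> pverts G" using x by (auto dest: wellformed')
    have xz: "(x, z) \<in> parcs G" using x arcs_symmetric by blast
    have ux: "gdist G u z = Suc (gdist G u x)" using x gdist_commute zV xV assms by metis
    have wx: "gdist G w x = Suc (gdist G w z)"
      using gdist_ends_cases[OF x(1) assms(3)] gdist_triangle[OF assms(1) xV assms(3)]
        ux zu gdist_commute[OF assms(3) xV] gdist_commute[OF assms(3) zV] by linarith
    \<comment> \<open>Otherwise the neighbour \<open>x\<close> of \<open>z\<close> towards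
      \<open>u\<close> would lie on both geodesics and be farther from \<open>w\<close> than
      \<open>z\<close>. So the edge between \<open>x\<close> and \<open>z\<close> separates
      \<open>u\<close> from \<open>v\<close>, and their geodesic passes through
      \<open>z\<close>.\<close>
    have "gdist G v z < gdist G v x"
    proof (rule ccontr)
      assume "\<not> ?thesis"
      then have "gdist G v z = Suc (gdist G v x)" using gdist_ends_cases[OF x(1) assms(2)] by auto
      then have "x \<in> A" using xV ux wx zu zv gdist_commute[OF assms(3) xV] gdist_commute[OF assms(3) zV]
        by (auto simp: A_def)
      from zmax[OF this] wx gdist_commute[OF assms(3) xV] gdist_commute[OF assms(3) zV]
      show False by simp
    qed
    with ux have "gdist G u v = gdist G u x + 1 + gdist G z v"
      by (intro gdist_across[OF xz assms(1) _ assms(2)]) auto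
    with ux show ?thesis by simp
  qed
  with zV zu zv that show ?thesis by blast
qed

lemma ancestor_iff:
  assumes "v \<in> pverts G"
  shows "ancestor G z v \<longleftrightarrow>
    z \<in> pverts G \<and> (\<exists>w\<in>weight_centers G. gdist G v w = level G v \<and> gdist G v z + gdist G z w = gdist G v w)"
  unfolding ancestor_def awalk_verts_with_proj_eq
  using on_apath_iff[OF assms] weight_centers_subset by blast

text \<open>\<open>w\<close> is the only nearest center of both vertices, which covers a single
  center as well as two vertices on one side of the center edge. The median of \<open>u\<close>,
  \<open>v\<close>, \<open>w\<close> is the common ancestor of largest level, and the geodesic
  between \<open>u\<close> and \<open>v\<close> turns around there.\<close>

lemma phi_same_center:
  assumes V: "u \<in> pverts G" "v \<in> pverts G" and w: "w \<in> weight_centers G"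
    and lev: "\<And>x c. x \<in> {u, v} \<Longrightarrow> c \<in> weight_centers G \<Longrightarrow> gdist G x c = level G x \<longleftrightarrow> c = w"
  shows "gdist G u v + 2 * phi G u v = level G u + level G v"
proof -
  have wV: "w \<in> pverts G" using w weight_centers_subset by auto
  define A where "A = {z \<in> pverts G. ancestor G z u \<and> ancestor G z v}"
  have A: "A = {z \<in> pverts G. gdist G u z + gdist G z w = gdist G u w \<and>
    gdist G v z + gdist G z w = gdist G v w}"
    unfolding A_def using ancestor_iff[OF V(1)] ancestor_iff[OF V(2)] lev w by auto
  have lu: "level G u = gdist G u w" "level G v = gdist G v w" using lev[of u w] lev[of v w] w by auto
  \<comment> \<open>\<open>w\<close> is also nearest to a common ancestor \<open>z\<close>, since a
    center closer to \<open>z\<close> would be closer to \<open>u\<close> too.\<close>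
  have level: "level G z = gdist G z w" if "z \<in> A" for z
  proof (rule antisym[OF level_le[OF w]])
    obtain c where c: "c \<in> weight_centers G" "level G z = gdist G z c" using level_attained .
    then have "c \<in> pverts G" using weight_centers_subset by auto
    with that V have "gdist G u c \<le> gdist G u z + gdist G z c" by (intro gdist_triangle) (auto simp: A)
    moreover have "gdist G u w \<le> gdist G u c" using level_le[OF c(1), of u] lu by simp
    ultimately show "gdist G z w \<le> level G z" using that c by (simp add: A)
  qed
  obtain m where m: "m \<in> A" and muv: "gdist G u m + gdist G m v = gdist G u v"
    using median[OF V wV] by (auto simp: A)
  have "phi G u v = Max (level G ` A)" using m by (auto simp: phi_def A_def[symmetric])
  also have "\<dots> = level G m"
  proof (rule Max_eqI)
    show "finite (level G ` A)" using finite_verts by (simp add: A)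
    show "level G m \<in> level G ` A" using m by simp
    fix y assume "y \<in> level G ` A"
    then obtain z where z: "z \<in> A" "y = level G z" by auto
    \<comment> \<open>Since \<open>z\<close> lies on both geodesics to \<open>w\<close>, a larger
      level means a shorter route from \<open>u\<close> to \<open>v\<close> via \<open>z\<close>; no
      route is shorter than the one via \<open>m\<close>.\<close>
    have "gdist G u v \<le> gdist G u z + gdist G z v" using gdist_triangle z V by (simp add: A)
    moreover have "gdist G m v = gdist G v m" "gdist G z v = gdist G v z"
      using gdist_commute V m z by (auto simp: A)
    ultimately show "y \<le> level G m" using z m muv level by (auto simp: A)
  qed
  finally show ?thesis
    using level[OF m] m muv lu gdist_commute[of m v] V by (auto simp: A)
qed

text \<open>For vertices on opposite sides, phi takes its default value 0 because no common ancestor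
  exists, and crossing the center edge costs the 1 counted by delta.\<close>

lemma gdist_formula:
  assumes V: "u \<in> pverts G" "v \<in> pverts G"
  shows "gdist G u v + 2 * phi G u v = level G u + level G v + delta G u v"
proof (cases rule: weight_centers_cases)
  case (one w)
  then have "level G x = gdist G x w" for x by (simp add: level_def)
  then show ?thesis
    using phi_same_center[OF V, of w] one delta_one_center[OF one(2)] by simp
next
  case (two a b)
  have ba: "(b, a) \<in> parcs G" using two arcs_symmetric by blast
  have VV: "a \<in> pverts G" "b \<in> pverts G" using two by (auto dest: wellformed')
  have level: "level G x = min (gdist G x a) (gdist G x b)" for x using two by (simp add: level_def)
  have neq: "gdist G x a \<noteq> gdist G x b" if "x \<in> {u, v}" for x
    using gdist_ends_neq[OF two(1)] that V by auto
  \<comment> \<open>Stated for any order \<open>c\<close>, \<open>e\<close> of the centers, so that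
    it serves both opposite cases below.\<close>
  have opp: "gdist G x y + 2 * phi G x y = level G x + level G y + 1"
    if E: "(c, e) \<in> parcs G" "weight_centers G = {c, e}" and x: "x \<in> near G c e" and y: "y \<in> near G e c"
    for c e x y
  proof -
    have P: "x \<in> pverts G" "y \<in> pverts G" "gdist G x c < gdist G x e" "gdist G y e < gdist G y c"
      using x y by (auto simp: near_def)
    have PV: "c \<in> pverts G" "e \<in> pverts G" using E by (auto dest: wellformed')
    have ec: "(e, c) \<in> parcs G" using E arcs_symmetric by blast
    have lv: "level G x = gdist G x c" "level G y = gdist G y e"
      using P E by (auto simp: level_def)
    \<comment> \<open>A common ancestor lies on one side of the center edge. The vertex on the other
      side would have to cross that edge to reach it, and by then it has already passed its own
      center.\<close>
    have "False" if z: "z \<in> pverts G" "ancestor G z x" "ancestor G z y" for z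
    proof -
      have zx: "gdist G x z + gdist G z c = gdist G x c"
        using ancestor_iff[OF P(1)] z E P lv by auto
      have zy: "gdist G y z + gdist G z e = gdist G y e"
        using ancestor_iff[OF P(2)] z E P lv by auto
      consider "gdist G z c < gdist G z e" | "gdist G z e < gdist G z c"
        using gdist_ends_neq[OF E(1) z(1)] by linarith
      then show False
      proof cases
        case 1
        from gdist_across[OF ec P(2,4) z(1) 1] zy show False by simp
      next
        case 2
        from gdist_across[OF E(1) P(1,3) z(1) 2] zx show False by simp
      qed
    qed
    then have "{z \<in> pverts G. ancestor G z x \<and> ancestor G z y} = {}" by auto
    then have "phi G x y = 0" by (simp add: phi_def)
    then show ?thesis
      using gdist_across[OF E(1) P(1,3) P(2,4)] lv gdist_commute[OF P(2) PV(2)] by simp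
  qed
  have side: "x \<notin> near G a b \<longleftrightarrow> x \<in> near G b a" if "x \<in> {u, v}" for x
    using neq[OF that] that V by (auto simp: near_def)
  consider "u \<in> near G a b" "v \<in> near G a b" | "u \<in> near G b a" "v \<in> near G b a"
    | "u \<in> near G a b" "v \<in> near G b a" | "u \<in> near G b a" "v \<in> near G a b" using side by blast
  then show ?thesis
  proof cases
    case 1
    have "delta G u v = 0" using delta_two_centers[OF two(1,2) V] 1 by simp
    moreover have "gdist G u v + 2 * phi G u v = level G u + level G v"
      by (rule phi_same_center[OF V, of a]) (use 1 two level in \<open>auto simp: near_def\<close>)
    ultimately show ?thesis by simp
  next
    case 2
    have "delta G u v = 0" using delta_two_centers[OF two(1,2) V] 2 side by simp
    moreover have "gdist G u v + 2 * phi G u v = level G u + level G v"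
      by (rule phi_same_center[OF V, of b]) (use 2 two level in \<open>auto simp: near_def\<close>)
    ultimately show ?thesis by simp
  next
    case 3
    have "delta G u v = 1" using delta_two_centers[OF two(1,2) V] 3 side by simp
    then show ?thesis using opp[OF two(1,2) 3] by simp
  next
    case 4
    have "delta G u v = 1" using delta_two_centers[OF two(1,2) V] 4 side by simp
    then show ?thesis using opp[of b a u v] ba two(2) 4 by (simp add: insert_commute)
  qed
qed

end


section \<open>Cartesian products\<close>

lemma cart_prod_simps [simp]:
  "pverts (cart_prod G H) = pverts G \<times> pverts H"
  "((x, y), (x', y')) \<in> parcs (cart_prod G H) \<longleftrightarrow>
     x = x' \<and> x \<in> pverts G \<and> (y, y') \<in> parcs H \<or> y = y' \<and> y \<in> pverts H \<and> (x, x') \<in> parcs G"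
  by (auto simp: cart_prod_def)

locale conn_graph_pair = T1: conn_graph T1 + T2: conn_graph T2
  for T1 :: "'a pair_pre_digraph" and T2 :: "'b pair_pre_digraph"
begin

lemma pair_graph_cart_prod: "pair_graph (cart_prod T1 T2)"
proof
  show "symmetric (with_proj (cart_prod T1 T2))"
    unfolding symmetric_def by (rule symI) (auto intro: T1.arcs_symmetric T2.arcs_symmetric)
  have "parcs (cart_prod T1 T2) \<subseteq> (pverts T1 \<times> pverts T2) \<times> (pverts T1 \<times> pverts T2)"
    by (auto dest: T1.wellformed' T2.wellformed')
  then show "finite (parcs (cart_prod T1 T2))"
    by (rule finite_subset) simp
qed (auto dest: T1.wellformed' T2.wellformed' T1.no_loops' T2.no_loops')

sublocale P: pair_graph "cart_prod T1 T2" by (rule pair_graph_cart_prod)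

lemma awalk_left:
  assumes "T1.awalk x p x'" "y \<in> pverts T2"
  shows "P.awalk (x, y) (map (\<lambda>(a, b). ((a, y), (b, y))) p) (x', y)"
  using assms(1)
proof (induction p arbitrary: x)
  case Nil
  then show ?case using assms(2) by (auto simp: T1.awalk_Nil_iff P.awalk_Nil_iff)
next
  case (Cons e p)
  then show ?case using assms(2) by (cases e) (simp add: T1.awalk_Cons_iff P.awalk_Cons_iff)
qed

lemma awalk_right:
  assumes "T2.awalk y p y'" "x \<in> pverts T1"
  shows "P.awalk (x, y) (map (\<lambda>(a, b). ((x, a), (x, b))) p) (x, y')"
  using assms(1)
proof (induction p arbitrary: y)
  case Nil
  then show ?case using assms(2) by (auto simp: T2.awalk_Nil_iff P.awalk_Nil_iff)
next
  case (Cons e p)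
  then show ?case using assms(2) by (cases e) (simp add: T2.awalk_Cons_iff P.awalk_Cons_iff)
qed

lemma awalk_cart_prod:
  assumes "T1.awalk x p x'" "T2.awalk y q y'"
  shows "\<exists>r. P.awalk (x, y) r (x', y') \<and> length r = length p + length q"
proof -
  have V: "y \<in> pverts T2" "x' \<in> pverts T1"
    using T2.awalk_hd_in_verts[OF assms(2)] T1.awalk_last_in_verts[OF assms(1)] by auto
  from P.awalk_appendI[OF awalk_left[OF assms(1) V(1)] awalk_right[OF assms(2) V(2)]]
  show ?thesis by - (rule exI, rule conjI, assumption, simp)
qed

lemma conn_graph_cart_prod: "conn_graph (cart_prod T1 T2)"
proof
  have "reachable (with_proj (cart_prod T1 T2)) u v"
    if "u \<in> pverts (cart_prod T1 T2)" "v \<in> pverts (cart_prod T1 T2)" for u v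
  proof -
    obtain x y x' y' where "u = (x, y)" "v = (x', y')" by (cases u, cases v)
    moreover from this that obtain p q where "T1.awalk x p x'" "T2.awalk y q y'"
      using T1.walk_exists T2.walk_exists by fastforce
    ultimately show ?thesis using awalk_cart_prod P.reachable_awalkI by blast
  qed
  then show "connected (with_proj (cart_prod T1 T2))"
    using T1.pverts_nonempty T2.pverts_nonempty P.reachable_mk_symmetricI
    by (auto simp: connected_def strongly_connected_def)
qed

sublocale P: conn_graph "cart_prod T1 T2" by (rule conn_graph_cart_prod)

lemma gdist_cart_prod:
  assumes "u \<in> pverts T1 \<times> pverts T2" "v \<in> pverts T1 \<times> pverts T2"
  shows "gdist (cart_prod T1 T2) u v = gdist T1 (fst u) (fst v) + gdist T2 (snd u) (snd v)"
proof (rule antisym)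
  obtain x y x' y' where uv: "u = (x, y)" "v = (x', y')" by (cases u, cases v)
  then have V: "x \<in> pverts T1" "x' \<in> pverts T1" "y \<in> pverts T2" "y' \<in> pverts T2" using assms by auto
  obtain p where p: "T1.awalk x p x'" "length p = gdist T1 x x'" using T1.shortest_walk[OF V(1,2)] .
  obtain q where q: "T2.awalk y q y'" "length q = gdist T2 y y'" using T2.shortest_walk[OF V(3,4)] .
  obtain r where "P.awalk (x, y) r (x', y')" "length r = length p + length q"
    using awalk_cart_prod[OF p(1) q(1)] by blast
  with P.gdist_le_length[OF this(1)] p q uv
  show "gdist (cart_prod T1 T2) u v \<le> gdist T1 (fst u) (fst v) + gdist T2 (snd u) (snd v)" by simp
  \<comment> \<open>An arc of the product moves in one coordinate only, so the sum of the factor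
    distances from \<open>u\<close> is a potential; it vanishes at \<open>u\<close>.\<close>
  define f where "f z = gdist T1 x (fst z) + gdist T2 y (snd z)" for z
  have "f v \<le> f u + gdist (cart_prod T1 T2) u v"
  proof (rule P.potential_le_gdist)
    fix s t assume st: "(s, t) \<in> parcs (cart_prod T1 T2)"
    obtain a b c e where "s = (a, b)" "t = (c, e)" by (cases s, cases t)
    with st consider "a = c" "(b, e) \<in> parcs T2" "s = (a, b)" "t = (c, e)"
      | "b = e" "(a, c) \<in> parcs T1" "s = (a, b)" "t = (c, e)" by auto
    then show "f t \<le> f s + 1"
    proof cases
      case 1
      then show ?thesis
        using T2.gdist_triangle[of y b e] T2.gdist_arc[of b e] V by (auto simp: f_def dest: T2.wellformed')
    next
      case 2
      then show ?thesis
        using T1.gdist_triangle[of x a c] T1.gdist_arc[of a c] V by (auto simp: f_def dest: T1.wellformed')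
    qed
  qed (use assms in auto)
  then show "gdist T1 (fst u) (fst v) + gdist T2 (snd u) (snd v) \<le> gdist (cart_prod T1 T2) u v"
    using uv V by (simp add: f_def)
qed

lemma diam_cart_prod: "diam (cart_prod T1 T2) = diam T1 + diam T2"
proof (rule antisym)
  obtain u v where uv: "u \<in> pverts (cart_prod T1 T2)" "v \<in> pverts (cart_prod T1 T2)"
    "gdist (cart_prod T1 T2) u v = diam (cart_prod T1 T2)" using P.diam_attained .
  then have "gdist T1 (fst u) (fst v) \<le> diam T1" "gdist T2 (snd u) (snd v) \<le> diam T2"
    by (auto intro!: T1.gdist_le_diam T2.gdist_le_diam)
  then show "diam (cart_prod T1 T2) \<le> diam T1 + diam T2" using uv gdist_cart_prod[of u v] by simp
  obtain x x' where x: "x \<in> pverts T1" "x' \<in> pverts T1" "gdist T1 x x' = diam T1"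
    using T1.diam_attained .
  obtain y y' where y: "y \<in> pverts T2" "y' \<in> pverts T2" "gdist T2 y y' = diam T2"
    using T2.diam_attained .
  show "diam T1 + diam T2 \<le> diam (cart_prod T1 T2)"
    using P.gdist_le_diam[of "(x, y)" "(x', y')"] gdist_cart_prod[of "(x, y)" "(x', y')"] x y by simp
qed

lemma vertex_weight_cart_prod:
  assumes "z \<in> pverts T1 \<times> pverts T2"
  shows "vertex_weight (cart_prod T1 T2) z =
    card (pverts T2) * vertex_weight T1 (fst z) + card (pverts T1) * vertex_weight T2 (snd z)"
proof -
  have "vertex_weight (cart_prod T1 T2) z =
      (\<Sum>u\<in>pverts T1 \<times> pverts T2. gdist T1 (fst u) (fst z) + gdist T2 (snd u) (snd z))"
    unfolding vertex_weight_def by (rule sum.cong) (use assms gdist_cart_prod in auto)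
  also have "\<dots> = (\<Sum>a\<in>pverts T1. \<Sum>b\<in>pverts T2. gdist T1 a (fst z) + gdist T2 b (snd z))"
    by (simp add: sum.cartesian_product split_def)
  finally show ?thesis
    by (simp add: vertex_weight_def sum.distrib sum_distrib_left)
qed

text \<open>By the previous lemma the weight is a positive combination of the coordinate weights,
  hence it is minimized in each coordinate separately.\<close>

lemma weight_centers_cart_prod:
  "weight_centers (cart_prod T1 T2) = weight_centers T1 \<times> weight_centers T2"
proof (rule set_eqI)
  fix z :: "'a \<times> 'b"
  obtain x y where z: "z = (x, y)" by (cases z)
  have c: "card (pverts T1) > 0" "card (pverts T2) > 0"
    using T1.pverts_nonempty T2.pverts_nonempty by (auto simp: card_gt_0_iff)
  show "z \<in> weight_centers (cart_prod T1 T2) \<longleftrightarrow> z \<in> weight_centers T1 \<times> weight_centers T2"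
  proof
    assume "z \<in> weight_centers (cart_prod T1 T2)"
    then have V: "x \<in> pverts T1" "y \<in> pverts T2"
      and min: "\<And>u. u \<in> pverts T1 \<times> pverts T2 \<Longrightarrow>
        vertex_weight (cart_prod T1 T2) (x, y) \<le> vertex_weight (cart_prod T1 T2) u"
      using z by (auto simp: weight_centers_def)
    have "vertex_weight T1 x \<le> vertex_weight T1 u" if "u \<in> pverts T1" for u
      using min[of "(u, y)"] that V c by (simp add: vertex_weight_cart_prod)
    moreover have "vertex_weight T2 y \<le> vertex_weight T2 u" if "u \<in> pverts T2" for u
      using min[of "(x, u)"] that V c by (simp add: vertex_weight_cart_prod)
    ultimately show "z \<in> weight_centers T1 \<times> weight_centers T2"
      using z V by (auto simp: weight_centers_def)
  next
    assume "z \<in> weight_centers T1 \<times> weight_centers T2"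
    then show "z \<in> weight_centers (cart_prod T1 T2)"
      using z by (auto simp: weight_centers_def vertex_weight_cart_prod intro!: add_mono mult_le_mono)
  qed
qed

lemma sum_prod_level:
  "(\<Sum>z\<in>pverts (cart_prod T1 T2). prod_level T1 T2 z) =
    card (pverts T2) * total_level T1 + card (pverts T1) * total_level T2"
proof -
  have "(\<Sum>z\<in>pverts (cart_prod T1 T2). prod_level T1 T2 z) =
      (\<Sum>a\<in>pverts T1. \<Sum>b\<in>pverts T2. level T1 a + level T2 b)"
    by (simp add: prod_level_def sum.cartesian_product split_def)
  then show ?thesis
    by (simp add: total_level_def sum.distrib sum_distrib_left)
qed

lemma prod_level_eq_0_iff:
  assumes "z \<in> pverts (cart_prod T1 T2)"
  shows "prod_level T1 T2 z = 0 \<longleftrightarrow> z \<in> weight_centers (cart_prod T1 T2)"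
  using assms T1.level_eq_0_iff T2.level_eq_0_iff
  by (auto simp: prod_level_def weight_centers_cart_prod)

end

locale tree_graph_pair = T1: tree_graph T1 + T2: tree_graph T2
  for T1 :: "'a pair_pre_digraph" and T2 :: "'b pair_pre_digraph"
begin

sublocale conn_graph_pair T1 T2 by unfold_locales

lemma prod_gdist_formula:
  assumes "u \<in> pverts (cart_prod T1 T2)" "v \<in> pverts (cart_prod T1 T2)"
  shows "gdist (cart_prod T1 T2) u v + 2 * prod_phi T1 T2 u v =
    prod_level T1 T2 u + prod_level T1 T2 v + prod_delta T1 T2 u v"
proof -
  have V: "fst u \<in> pverts T1" "fst v \<in> pverts T1" "snd u \<in> pverts T2" "snd v \<in> pverts T2"
    using assms by auto
  show ?thesis
    using T1.gdist_formula[OF V(1,2)] T2.gdist_formula[OF V(3,4)] gdist_cart_prod[of u v] assms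
    by (simp add: prod_phi_def prod_level_def prod_delta_def)
qed

lemma prod_delta_le_xi: "prod_delta T1 T2 u v \<le> xi T1 T2"
proof -
  have "delta T1 (fst u) (fst v) < card (weight_centers T1)"
    "delta T2 (snd u) (snd v) < card (weight_centers T2)"
    by (rule T1.delta_less_card T2.delta_less_card)+
  then show ?thesis by (simp add: xi_def prod_delta_def)
qed

end


section \<open>Radio labelings along an ordering\<close>

context conn_graph
begin

text \<open>The least label increase that the radio condition allows at step \<open>t\<close>;
  integers avoid truncation in sums and comparisons.\<close>

definition step_gap :: "(nat \<Rightarrow> 'a) \<Rightarrow> nat \<Rightarrow> int" where
  "step_gap z t = int (diam G) + 1 - int (gdist G (z t) (z (t + 1)))"

text \<open>The span when every consecutive condition is tight.\<close>

definition tour :: "(nat \<Rightarrow> 'a) \<Rightarrow> int" where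
  "tour z = (\<Sum>t<card (pverts G) - 1. step_gap z t)"

lemma radio_labeling_gap:
  assumes "radio_labeling G f" "u \<in> pverts G" "v \<in> pverts G" "f u < f v"
  shows "int (f v) - int (f u) \<ge> int (diam G) + 1 - int (gdist G u v)"
proof -
  have "u \<noteq> v" using assms by auto
  then have "\<bar>int (f u) - int (f v)\<bar> \<ge> int (diam G) + 1 - int (gdist G u v)"
    using assms unfolding radio_labeling_def by blast
  then show ?thesis using assms(4) by linarith
qed

text \<open>Distances never exceed the diameter, so distinct vertices need labels at least 1
  apart.\<close>

lemma radio_labeling_inj:
  assumes "radio_labeling G f"
  shows "inj_on f (pverts G)"
proof (rule inj_onI, rule ccontr)
  fix u v assume uv: "u \<in> pverts G" "v \<in> pverts G" "f u = f v" "u \<noteq> v"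
  then have "\<bar>int (f u) - int (f v)\<bar> \<ge> int (diam G) + 1 - int (gdist G u v)"
    using assms unfolding radio_labeling_def by blast
  then show False using gdist_le_diam[OF uv(1,2)] uv(3) by simp
qed

lemma card_pverts_pos: "card (pverts G) > 0"
  using pverts_nonempty by (simp add: card_gt_0_iff)

lemma label_span_ordering:
  assumes bij: "bij_betw z {..<card (pverts G)} (pverts G)"
    and less: "\<And>s t. s < t \<Longrightarrow> t < card (pverts G) \<Longrightarrow> f (z s) < f (z t)"
  shows "int (label_span G f) = int (f (z (card (pverts G) - 1))) - int (f (z 0))"
proof -
  let ?p = "card (pverts G)"
  have V: "pverts G = z ` {..<?p}" using bij by (simp add: bij_betw_def)
  have le: "f (z s) \<le> f (z t)" if "s \<le> t" "t < ?p" for s t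
    using less[of s t] that by (cases "s = t") auto
  have "Max (f ` pverts G) = f (z (?p - 1))"
  proof (rule Max_eqI)
    show "y \<le> f (z (?p - 1))" if "y \<in> f ` pverts G" for y
    proof -
      from that obtain t where "t < ?p" "y = f (z t)" by (subst (asm) V) auto
      then show ?thesis using le[of t "?p - 1"] by simp
    qed
    have "z (?p - 1) \<in> pverts G" using bij card_pverts_pos by (auto simp: bij_betw_def)
    then show "f (z (?p - 1)) \<in> f ` pverts G" by simp
  qed simp
  moreover have "Min (f ` pverts G) = f (z 0)"
  proof (rule Min_eqI)
    show "f (z 0) \<le> y" if "y \<in> f ` pverts G" for y
    proof -
      from that obtain t where "t < ?p" "y = f (z t)" by (subst (asm) V) auto
      then show ?thesis using le[of 0 t] by simp
    qed
    have "z 0 \<in> pverts G" using bij card_pverts_pos by (auto simp: bij_betw_def)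
    then show "f (z 0) \<in> f ` pverts G" by simp
  qed simp
  moreover have "f (z 0) \<le> f (z (?p - 1))" using le[of 0 "?p - 1"] card_pverts_pos by simp
  ultimately show ?thesis by (simp add: label_span_def)
qed

lemma radio_labeling_ordering:
  assumes "radio_labeling G f"
  obtains z where "bij_betw z {..<card (pverts G)} (pverts G)"
    "\<And>s t. s < t \<Longrightarrow> t < card (pverts G) \<Longrightarrow> f (z s) < f (z t)"
proof -
  let ?p = "card (pverts G)"
  define xs where "xs = sorted_list_of_set (f ` pverts G)"
  have inj: "inj_on f (pverts G)" using radio_labeling_inj[OF assms] .
  have xs: "sorted xs" "distinct xs" "set xs = f ` pverts G" "length xs = ?p"
    using inj by (auto simp: xs_def card_image)
  have "bij_betw ((!) xs) {..<?p} (f ` pverts G)"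
    using bij_betw_nth[of xs "{..<?p}" "f ` pverts G"] xs by auto
  moreover have "bij_betw (inv_into (pverts G) f) (f ` pverts G) (pverts G)"
    using inj by (simp add: bij_betw_inv_into inj_on_imp_bij_betw)
  ultimately have bij: "bij_betw (inv_into (pverts G) f \<circ> (!) xs) {..<?p} (pverts G)"
    by (rule bij_betw_trans)
  have val: "f ((inv_into (pverts G) f \<circ> (!) xs) t) = xs ! t" if "t < ?p" for t
  proof -
    have "xs ! t \<in> f ` pverts G" using that xs by (metis nth_mem)
    then show ?thesis by (simp add: f_inv_into_f)
  qed
  have "xs ! s < xs ! t" if "s < t" "t < ?p" for s t
    using that xs by (simp add: strict_sorted_iff sorted_wrt_nth_less)
  with val have "f ((inv_into (pverts G) f \<circ> (!) xs) s) < f ((inv_into (pverts G) f \<circ> (!) xs) t)"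
    if "s < t" "t < ?p" for s t using that by simp
  with bij that show ?thesis by blast
qed

text \<open>Ensures that the \<open>LEAST\<close> in \<open>radio_number\<close> is attained.
  Distinct multiples of \<open>diam G + 1\<close> meet the condition whatever the distances
  are.\<close>

lemma radio_labeling_exists: "\<exists>f. radio_labeling G f"
proof -
  obtain h where h: "bij_betw h (pverts G) {0..<card (pverts G)}"
    using ex_bij_betw_finite_nat[OF finite_verts] by blast
  have "\<bar>int ((diam G + 1) * h u) - int ((diam G + 1) * h v)\<bar> \<ge> int (diam G) + 1"
    if "u \<in> pverts G" "v \<in> pverts G" "u \<noteq> v" for u v
  proof -
    have "h u \<noteq> h v" using h that by (auto simp: bij_betw_def inj_on_def)
    then have "\<bar>int (h u) - int (h v)\<bar> \<ge> 1" by linarith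
    then have "(int (diam G) + 1) * 1 \<le> (int (diam G) + 1) * \<bar>int (h u) - int (h v)\<bar>"
      by (intro mult_left_mono) auto
    also have "\<dots> = \<bar>(int (diam G) + 1) * (int (h u) - int (h v))\<bar>" by (simp add: abs_mult)
    finally show ?thesis by (simp add: algebra_simps)
  qed
  then have "radio_labeling G (\<lambda>u. (diam G + 1) * h u)"
    unfolding radio_labeling_def by (smt (verit) of_nat_0_le_iff)
  then show ?thesis by blast
qed

lemma radio_number_attained:
  obtains f where "radio_labeling G f" "label_span G f = radio_number G"
proof -
  have "\<exists>k f. radio_labeling G f \<and> label_span G f = k" using radio_labeling_exists by blast
  from LeastI_ex[OF this] show ?thesis using that unfolding radio_number_def by blast
qed

lemma radio_number_le: "radio_labeling G f \<Longrightarrow> radio_number G \<le> label_span G f"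
  unfolding radio_number_def by (rule Least_le) blast

lemma sum_diff_telescope:
  fixes g :: "nat \<Rightarrow> int"
  assumes "a \<le> b"
  shows "(\<Sum>t = a..<b. g (t + 1) - g t) = g b - g a"
  using sum_Suc_diff'[OF assms, of g] by simp

text \<open>In increasing order of labels every increase is at least the gap, so each span is at
  least some tour, hence at least \<open>B\<close>. Span \<open>B\<close> makes all these
  inequalities equalities; conversely, partial sums of gaps serve as labels.\<close>

lemma radio_number_eq_iff:
  assumes lower: "\<And>z. bij_betw z {..<card (pverts G)} (pverts G) \<Longrightarrow> B \<le> tour z"
  shows "int (radio_number G) = B \<longleftrightarrow>
    (\<exists>z. bij_betw z {..<card (pverts G)} (pverts G) \<and> tour z = B \<and>
      (\<forall>a b. a < b \<and> b \<le> card (pverts G) - 1 \<longrightarrow>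
        int (diam G) + 1 - int (gdist G (z a) (z b)) \<le> (\<Sum>t = a..<b. step_gap z t)))"
    (is "?L \<longleftrightarrow> (\<exists>z. ?bij z \<and> _ \<and> ?cond z)")
proof -
  let ?p = "card (pverts G)"
  have p0: "?p > 0" by (rule card_pverts_pos)
  have gaps: "step_gap z t \<le> int (f (z (t + 1))) - int (f (z t))"
    if f: "radio_labeling G f" and bij: "?bij z"
      and less: "\<And>s t. s < t \<Longrightarrow> t < ?p \<Longrightarrow> f (z s) < f (z t)" and t: "t < ?p - 1" for f z t
  proof -
    have "z t \<in> pverts G" "z (t + 1) \<in> pverts G" using bij t by (auto simp: bij_betw_def)
    then show ?thesis
      unfolding step_gap_def using radio_labeling_gap[OF f] less[of t "t + 1"] t by simp
  qed
  have span_ge: "B \<le> int (label_span G f)" if f: "radio_labeling G f" for f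
  proof -
    obtain z where z: "?bij z" "\<And>s t. s < t \<Longrightarrow> t < ?p \<Longrightarrow> f (z s) < f (z t)"
      using radio_labeling_ordering[OF f] by blast
    have "tour z \<le> (\<Sum>t<?p - 1. int (f (z (t + 1))) - int (f (z t)))"
      unfolding tour_def by (rule sum_mono) (use gaps[OF f z] in simp)
    also have "\<dots> = int (label_span G f)"
      using label_span_ordering[of z f, OF z] sum_diff_telescope[of 0 "?p - 1" "\<lambda>t. int (f (z t))"]
      by (simp add: atLeast0LessThan)
    finally show ?thesis using lower[OF z(1)] by simp
  qed
  show ?thesis
  proof
    assume L: ?L
    obtain f where f: "radio_labeling G f" "label_span G f = radio_number G"
      using radio_number_attained .
    obtain z where z: "?bij z" "\<And>s t. s < t \<Longrightarrow> t < ?p \<Longrightarrow> f (z s) < f (z t)"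
      using radio_labeling_ordering[OF f(1)] by blast
    have tel: "(\<Sum>t<?p - 1. int (f (z (t + 1))) - int (f (z t))) = B"
      using label_span_ordering[of z f, OF z] sum_diff_telescope[of 0 "?p - 1" "\<lambda>t. int (f (z t))"] f L
      by (simp add: atLeast0LessThan)
    have g: "step_gap z t \<le> int (f (z (t + 1))) - int (f (z t))" if "t \<in> {..<?p - 1}" for t
      using gaps[OF f(1) z] that by simp
    have "tour z \<le> (\<Sum>t<?p - 1. int (f (z (t + 1))) - int (f (z t)))"
      unfolding tour_def by (rule sum_mono) (rule g)
    then have tour: "tour z = B" using tel lower[OF z(1)] by simp
    \<comment> \<open>Termwise inequalities with equal sums are equalities.\<close>
    have eq: "step_gap z t = int (f (z (t + 1))) - int (f (z t))" if "t < ?p - 1" for t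
    proof (rule ccontr)
      assume "\<not> ?thesis"
      then have "step_gap z t < int (f (z (t + 1))) - int (f (z t))" using g that by force
      then have "tour z < (\<Sum>t<?p - 1. int (f (z (t + 1))) - int (f (z t)))"
        unfolding tour_def by (intro sum_strict_mono_ex1) (use g that in auto)
      then show False using tour tel by simp
    qed
    have "?cond z"
    proof (intro allI impI, elim conjE)
      fix a b assume ab: "a < b" "b \<le> ?p - 1"
      then have V: "z a \<in> pverts G" "z b \<in> pverts G" using z(1) p0 by (auto simp: bij_betw_def)
      have "(\<Sum>t = a..<b. step_gap z t) = (\<Sum>t = a..<b. int (f (z (t + 1))) - int (f (z t)))"
        by (rule sum.cong) (use eq ab in auto)
      also have "\<dots> = int (f (z b)) - int (f (z a))"
        using sum_diff_telescope[of a b "\<lambda>t. int (f (z t))"] ab by simp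
      finally show "int (diam G) + 1 - int (gdist G (z a) (z b)) \<le> (\<Sum>t = a..<b. step_gap z t)"
        using radio_labeling_gap[OF f(1) V] z(2)[of a b] ab p0 by simp
    qed
    with z(1) tour show "\<exists>z. ?bij z \<and> tour z = B \<and> ?cond z" by blast
  next
    assume "\<exists>z. ?bij z \<and> tour z = B \<and> ?cond z"
    then obtain z where z: "?bij z" "tour z = B" "?cond z" by blast
    \<comment> \<open>The tight labels, starting with 0 at \<open>z 0\<close>.\<close>
    define h where "h t = (\<Sum>s<t. step_gap z s)" for t
    have zV: "z t \<in> pverts G" if "t < ?p" for t using z(1) that by (auto simp: bij_betw_def)
    have pos: "step_gap z t \<ge> 1" if "t < ?p - 1" for t
      using gdist_le_diam[OF zV zV, of t "t + 1"] that by (simp add: step_gap_def)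
    have hdiff: "h b - h a = (\<Sum>t = a..<b. step_gap z t)" if "a \<le> b" for a b
      using sum_diff_nat_ivl[of 0 a b "step_gap z"] that by (simp add: h_def atLeast0LessThan)
    have h0: "h 0 = 0" by (simp add: h_def)
    have mono: "h s < h t" if st: "s < t" "t < ?p" for s t
    proof -
      have "0 < step_gap z i" if "i \<in> {s..<t}" for i
      proof -
        have "i < ?p - 1" using that st by auto
        from pos[OF this] show ?thesis by simp
      qed
      then have "0 < (\<Sum>t = s..<t. step_gap z t)"
        using st by (intro sum_pos) auto
      then show ?thesis using hdiff[of s t] st by simp
    qed
    have hnn: "h t \<ge> 0" if "t < ?p" for t
      using mono[of 0 t] h0 that by (cases "t = 0") auto
    \<comment> \<open>\<open>nat\<close> loses nothing, because \<open>h\<close> is nonnegative on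
      all indices of the ordering.\<close>
    define f where "f u = nat (h (the_inv_into {..<?p} z u))" for u
    have inv: "the_inv_into {..<?p} z (z t) = t" if "t < ?p" for t
      using z(1) that by (simp add: bij_betw_def the_inv_into_f_f)
    have fz: "int (f (z t)) = h t" if "t < ?p" for t
      using inv[OF that] hnn[OF that] by (simp add: f_def)
    have gap: "int (f (z b)) - int (f (z a)) \<ge> int (diam G) + 1 - int (gdist G (z a) (z b))"
      if "a < b" "b < ?p" for a b
    proof -
      have "int (diam G) + 1 - int (gdist G (z a) (z b)) \<le> (\<Sum>t = a..<b. step_gap z t)"
        using z(3) that by simp
      then show ?thesis using fz[of a] fz[of b] hdiff[of a b] that by simp
    qed
    have "radio_labeling G f"
      unfolding radio_labeling_def
    proof (intro ballI impI)
      fix u v assume uv: "u \<in> pverts G" "v \<in> pverts G" "u \<noteq> v"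
      have "pverts G = z ` {..<?p}" using z(1) by (simp add: bij_betw_def)
      with uv obtain a b where ab: "a < ?p" "b < ?p" "u = z a" "v = z b"
        by blast
      with uv consider "a < b" | "b < a" by fastforce
      then show "\<bar>int (f u) - int (f v)\<bar> \<ge> int (diam G) + 1 - int (gdist G u v)"
      proof cases
        case 1
        then show ?thesis using gap[of a b] ab by simp
      next
        case 2
        then show ?thesis using gap[of b a] ab gdist_commute[OF uv(1,2)] by simp
      qed
    qed
    moreover have "int (label_span G f) = B"
    proof -
      have "f (z s) < f (z t)" if "s < t" "t < ?p" for s t
        using mono[OF that] fz[of s] fz[of t] that by simp
      from label_span_ordering[of z f, OF z(1) this]
      have "int (label_span G f) = h (?p - 1) - h 0" using fz p0 by simp
      then show ?thesis using h0 z(2) by (simp add: tour_def h_def)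
    qed
    ultimately have "int (radio_number G) \<le> B" using radio_number_le by fastforce
    moreover have "B \<le> int (radio_number G)" using radio_number_attained span_ge by metis
    ultimately show ?L by simp
  qed
qed

end


section \<open>Orderings of a product of trees\<close>

declare cart_prod_simps(1) [simp del]

context tree_graph_pair
begin

text \<open>The truncated subtraction is exact by \<open>prod_delta_le_xi\<close>.\<close>

definition excess :: "(nat \<Rightarrow> 'a \<times> 'b) \<Rightarrow> nat \<Rightarrow> nat" where
  "excess z t = xi T1 T2 - prod_delta T1 T2 (z t) (z (t + 1)) + 2 * prod_phi T1 T2 (z t) (z (t + 1))"

text \<open>The part of the tour length that depends on the ordering.\<close>

definition slack :: "(nat \<Rightarrow> 'a \<times> 'b) \<Rightarrow> nat" where
  "slack z = prod_level T1 T2 (z 0) + prod_level T1 T2 (z (card (pverts (cart_prod T1 T2)) - 1))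
     + (\<Sum>t<card (pverts (cart_prod T1 T2)) - 1. excess z t)"

lemma excess_eq_0_iff: "excess z t = 0 \<longleftrightarrow> feasible_pair T1 T2 (z t) (z (t + 1))"
  using prod_delta_le_xi[of "z t" "z (t + 1)"] by (auto simp: excess_def feasible_pair_def)

lemma ordering_in_pverts:
  "bij_betw z {..<card (pverts (cart_prod T1 T2))} (pverts (cart_prod T1 T2)) \<Longrightarrow>
    t < card (pverts (cart_prod T1 T2)) \<Longrightarrow> z t \<in> pverts (cart_prod T1 T2)"
  by (auto simp: bij_betw_def)

text \<open>By the distance formula a gap is a constant minus the two levels plus the excess. Over
  all steps every level is subtracted twice, except that each of the two ends misses one
  subtraction, which \<open>slack\<close> adds back.\<close>

lemma tour_eq_slack:
  assumes bij: "bij_betw z {..<card (pverts (cart_prod T1 T2))} (pverts (cart_prod T1 T2))"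
  shows "P.tour z = (int (card (pverts (cart_prod T1 T2))) - 1) * (int (diam (cart_prod T1 T2)) + 1 - int (xi T1 T2))
    - 2 * int (\<Sum>v\<in>pverts (cart_prod T1 T2). prod_level T1 T2 v) + int (slack z)"
proof -
  define V where "V = pverts (cart_prod T1 T2)"
  define q where "q = card V - 1"
  have q: "card V = Suc q" using P.card_pverts_pos by (simp add: q_def V_def)
  define L where "L t = int (prod_level T1 T2 (z t))" for t
  have "(\<Sum>v\<in>V. int (prod_level T1 T2 v)) = (\<Sum>t<Suc q. L t)"
    using sum.reindex_bij_betw[OF bij, of "\<lambda>v. int (prod_level T1 T2 v)"] q by (simp add: V_def L_def)
  moreover have "(\<Sum>t<Suc q. L t) = (\<Sum>t<q. L t) + L q" by simp
  moreover have "(\<Sum>t<Suc q. L t) = L 0 + (\<Sum>t<q. L (t + 1))"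
    by (subst sum.lessThan_Suc_shift) simp
  ultimately have lev: "(\<Sum>t<q. L t + L (t + 1)) = 2 * (\<Sum>v\<in>V. int (prod_level T1 T2 v)) - L 0 - L q"
    by (simp add: sum.distrib)
  have gap: "P.step_gap z t = (int (diam (cart_prod T1 T2)) + 1 - int (xi T1 T2)) - (L t + L (t + 1)) + int (excess z t)"
    if "t \<in> {..<q}" for t
  proof -
    have "z t \<in> pverts (cart_prod T1 T2)" "z (t + 1) \<in> pverts (cart_prod T1 T2)"
      using ordering_in_pverts[OF bij] that q by (auto simp: V_def)
    from prod_gdist_formula[OF this] prod_delta_le_xi[of "z t" "z (t + 1)"]
    show ?thesis by (simp add: P.step_gap_def L_def excess_def)
  qed
  have "P.tour z = (\<Sum>t<q. P.step_gap z t)" by (simp add: P.tour_def q_def V_def)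
  also have "\<dots> = (\<Sum>t<q. (int (diam (cart_prod T1 T2)) + 1 - int (xi T1 T2)) - (L t + L (t + 1)) + int (excess z t))"
    by (rule sum.cong) (use gap in auto)
  also have "\<dots> = int q * (int (diam (cart_prod T1 T2)) + 1 - int (xi T1 T2)) - (\<Sum>t<q. L t + L (t + 1))
      + (\<Sum>t<q. int (excess z t))"
    by (simp add: sum.distrib sum_subtractf)
  finally show ?thesis
    unfolding lev using q by (simp add: slack_def L_def V_def[symmetric])
qed

text \<open>When both trees have two weight centers, \<open>C\<close> is the union of two opposite sectors.\<close>

lemma parity_class:
  assumes "card (weight_centers T1) = 2" "card (weight_centers T2) = 2"
  obtains C where "C \<subseteq> pverts (cart_prod T1 T2)" "2 * card C = card (pverts (cart_prod T1 T2))"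
    "\<And>u v. u \<in> pverts (cart_prod T1 T2) \<Longrightarrow> v \<in> pverts (cart_prod T1 T2) \<Longrightarrow>
       (u \<in> C \<longleftrightarrow> v \<in> C) \<longleftrightarrow> prod_delta T1 T2 u v \<noteq> 1"
proof -
  obtain a b where ab: "(a, b) \<in> parcs T1" "weight_centers T1 = {a, b}"
    "card (near T1 a b) = card (near T1 b a)"
    using assms(1) by (cases rule: T1.weight_centers_cases) auto
  obtain c e where ce: "(c, e) \<in> parcs T2" "weight_centers T2 = {c, e}"
    "card (near T2 c e) = card (near T2 e c)"
    using assms(2) by (cases rule: T2.weight_centers_cases) auto
  define C where "C = near T1 a b \<times> near T2 c e \<union> near T1 b a \<times> near T2 e c"
  have n1: "x \<in> near T1 b a \<longleftrightarrow> x \<notin> near T1 a b" if "x \<in> pverts T1" for x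
    using T1.near_Un[OF ab(1)] T1.near_disjoint[of a b] that by blast
  have n2: "x \<in> near T2 e c \<longleftrightarrow> x \<notin> near T2 c e" if "x \<in> pverts T2" for x
    using T2.near_Un[OF ce(1)] T2.near_disjoint[of c e] that by blast
  have sub: "C \<subseteq> pverts (cart_prod T1 T2)" by (auto simp: C_def near_def cart_prod_simps(1))
  \<comment> \<open>Both center edges are balanced, so each of the four sectors holds a quarter of
    the vertices and \<open>C\<close> holds half.\<close>
  have "card C = card (near T1 a b) * card (near T2 c e) + card (near T1 b a) * card (near T2 e c)"
    unfolding C_def
    by (subst card_Un_disjoint) (use T1.near_disjoint[of a b] in \<open>auto simp: T1.finite_near T2.finite_near card_cartesian_product\<close>)
  moreover have "card (pverts T1) = 2 * card (near T1 a b)" "card (pverts T2) = 2 * card (near T2 c e)"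
    using T1.card_near_add[OF ab(1)] T2.card_near_add[OF ce(1)] ab(3) ce(3) by simp_all
  ultimately have "2 * card C = card (pverts (cart_prod T1 T2))"
    using ab(3) ce(3) by (simp add: card_cartesian_product cart_prod_simps(1))
  moreover have "(u \<in> C \<longleftrightarrow> v \<in> C) \<longleftrightarrow> prod_delta T1 T2 u v \<noteq> 1"
    if "u \<in> pverts (cart_prod T1 T2)" "v \<in> pverts (cart_prod T1 T2)" for u v
  proof -
    have V: "fst u \<in> pverts T1" "fst v \<in> pverts T1" "snd u \<in> pverts T2" "snd v \<in> pverts T2"
      using that by (auto simp: cart_prod_simps(1))
    \<comment> \<open>\<open>C\<close> compares the sides on which the two coordinates lie. A delta
      of 1 switches exactly one of them and so leaves the class; switching none or both keeps
      it.\<close>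
    have C: "w \<in> C \<longleftrightarrow> (fst w \<in> near T1 a b \<longleftrightarrow> snd w \<in> near T2 c e)"
      if "fst w \<in> pverts T1" "snd w \<in> pverts T2" for w
      using n1[OF that(1)] n2[OF that(2)] by (cases w) (auto simp: C_def)
    show ?thesis
      using C[OF V(1,3)] C[OF V(2,4)] T1.delta_two_centers[OF ab(1,2) V(1,2)]
        T2.delta_two_centers[OF ce(1,2) V(3,4)]
      by (auto simp: prod_delta_def)
  qed
  ultimately show ?thesis using sub that by blast
qed

text \<open>Without excess every step has delta 2 and stays in one parity class, which misses half
  of the vertices.\<close>

lemma excess_sum_pos:
  assumes card: "card (weight_centers T1) = 2" "card (weight_centers T2) = 2"
    and bij: "bij_betw z {..<card (pverts (cart_prod T1 T2))} (pverts (cart_prod T1 T2))"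
  shows "(\<Sum>t<card (pverts (cart_prod T1 T2)) - 1. excess z t) \<noteq> 0"
proof
  let ?V = "pverts (cart_prod T1 T2)"
  assume "(\<Sum>t<card ?V - 1. excess z t) = 0"
  then have "excess z t = 0" if "t < card ?V - 1" for t using that by simp
  then have del: "prod_delta T1 T2 (z t) (z (t + 1)) = 2" if "t < card ?V - 1" for t
    using that card by (simp add: excess_eq_0_iff feasible_pair_def xi_def)
  obtain C where C: "C \<subseteq> ?V" "2 * card C = card ?V" "\<And>u v. u \<in> ?V \<Longrightarrow> v \<in> ?V \<Longrightarrow>
       (u \<in> C \<longleftrightarrow> v \<in> C) \<longleftrightarrow> prod_delta T1 T2 u v \<noteq> 1"
    using parity_class[OF card] by metis
  have const: "t < card ?V \<Longrightarrow> z t \<in> C \<longleftrightarrow> z 0 \<in> C" for t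
  proof (induction t)
    case (Suc t)
    then show ?case
      using C(3)[OF ordering_in_pverts[OF bij] ordering_in_pverts[OF bij], of t "t + 1"] del[of t] by simp
  qed simp
  have img: "?V = z ` {..<card ?V}" using bij by (simp add: bij_betw_def)
  have "v \<in> C \<longleftrightarrow> z 0 \<in> C" if "v \<in> ?V" for v
  proof -
    from that img obtain t where "t < card ?V" "v = z t" by blast
    then show ?thesis using const[of t] by blast
  qed
  then have "C = {} \<or> C = ?V" using C(1) by blast
  then show False using C(2) P.card_pverts_pos by auto
qed

text \<open>The ordering changes class only between the indices \<open>s\<close> and
  \<open>s + 1\<close>, so its first \<open>s + 1\<close> vertices form exactly one class, half of
  all vertices.\<close>

lemma switch_in_middle:
  assumes card: "card (weight_centers T1) = 2" "card (weight_centers T2) = 2"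
    and bij: "bij_betw z {..<card (pverts (cart_prod T1 T2))} (pverts (cart_prod T1 T2))"
    and s: "s < card (pverts (cart_prod T1 T2)) - 1" "prod_delta T1 T2 (z s) (z (s + 1)) = 1"
    and rest: "\<And>t. t < card (pverts (cart_prod T1 T2)) - 1 \<Longrightarrow> t \<noteq> s \<Longrightarrow>
      prod_delta T1 T2 (z t) (z (t + 1)) = 2"
  shows "s = card (pverts (cart_prod T1 T2)) div 2 - 1"
proof -
  let ?V = "pverts (cart_prod T1 T2)"
  obtain C where C: "C \<subseteq> ?V" "2 * card C = card ?V" "\<And>u v. u \<in> ?V \<Longrightarrow> v \<in> ?V \<Longrightarrow>
       (u \<in> C \<longleftrightarrow> v \<in> C) \<longleftrightarrow> prod_delta T1 T2 u v \<noteq> 1"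
    using parity_class[OF card] by metis
  have sides: "t < card ?V \<Longrightarrow> (z t \<in> C \<longleftrightarrow> z 0 \<in> C) \<longleftrightarrow> t \<le> s" for t
  proof (induction t)
    case (Suc t)
    have V: "z t \<in> ?V" "z (t + 1) \<in> ?V" using ordering_in_pverts[OF bij] Suc.prems by auto
    show ?case
    proof (cases "t = s")
      case True
      then show ?thesis using C(3)[OF V] s Suc by auto
    next
      case False
      then show ?thesis using C(3)[OF V] rest[of t] Suc by auto
    qed
  qed simp
  have img: "?V = z ` {..<card ?V}" and inj: "inj_on z {..<card ?V}" using bij by (auto simp: bij_betw_def)
  have card_first: "card (z ` {..s}) = s + 1"
    using s by (subst card_image) (auto intro: inj_on_subset[OF inj])
  have fin: "finite C" using finite_subset[OF C(1) P.finite_verts] .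
  have sub: "z ` {..s} \<subseteq> ?V" using s ordering_in_pverts[OF bij] by auto
  have "2 * (s + 1) = card ?V"
  proof (cases "z 0 \<in> C")
    case True
    have "C = z ` {..s}"
    proof
      show "C \<subseteq> z ` {..s}"
      proof
        fix v assume v: "v \<in> C"
        then obtain t where "t < card ?V" "v = z t" using C(1) img by blast
        then show "v \<in> z ` {..s}" using sides[of t] v True by auto
      qed
      have "z t \<in> C" if "t \<le> s" for t
        using sides[of t] s that True by simp
      then show "z ` {..s} \<subseteq> C" by blast
    qed
    then show ?thesis using card_first C(2) by simp
  next
    case False
    have "?V - C = z ` {..s}"
    proof
      show "?V - C \<subseteq> z ` {..s}"
      proof
        fix v assume v: "v \<in> ?V - C"
        then obtain t where "t < card ?V" "v = z t" using img by blast
        then show "v \<in> z ` {..s}" using sides[of t] v False by auto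
      qed
      have "z t \<notin> C" if "t \<le> s" for t
        using sides[of t] s that False by simp
      then show "z ` {..s} \<subseteq> ?V - C" using sub by blast
    qed
    moreover have "card (?V - C) = card ?V - card C" using card_Diff_subset[OF fin C(1)] .
    ultimately show ?thesis using card_first C(2) by simp
  qed
  then show ?thesis by simp
qed

section \<open>Orderings of least slack\<close>

definition min_slack :: nat where
  "min_slack = (if xi T1 T2 = 1 then 0 else 1)"

lemma center_count_cases:
  obtains (one) "card (weight_centers T1) = 1" "card (weight_centers T2) = 1" "xi T1 T2 = 0"
      "card (weight_centers (cart_prod T1 T2)) = 1"
  | (two) "card (weight_centers T1) * card (weight_centers T2) = 2" "xi T1 T2 = 1"
      "card (weight_centers (cart_prod T1 T2)) = 2"
  | (four) "card (weight_centers T1) = 2" "card (weight_centers T2) = 2" "xi T1 T2 = 2"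
      "card (weight_centers (cart_prod T1 T2)) = 4"
  using T1.card_weight_centers T2.card_weight_centers
  by (auto simp: xi_def weight_centers_cart_prod card_cartesian_product)

text \<open>Only one vertex has level 0, and with at least two vertices the ends are
  distinct.\<close>

lemma one_center_end_levels:
  assumes "card (weight_centers (cart_prod T1 T2)) = 1" "card (pverts (cart_prod T1 T2)) \<ge> 2"
    and bij: "bij_betw z {..<card (pverts (cart_prod T1 T2))} (pverts (cart_prod T1 T2))"
  shows "prod_level T1 T2 (z 0) + prod_level T1 T2 (z (card (pverts (cart_prod T1 T2)) - 1)) \<noteq> 0"
proof
  let ?p = "card (pverts (cart_prod T1 T2))"
  assume "prod_level T1 T2 (z 0) + prod_level T1 T2 (z (?p - 1)) = 0"
  then have "z 0 \<in> weight_centers (cart_prod T1 T2)" "z (?p - 1) \<in> weight_centers (cart_prod T1 T2)"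
    using prod_level_eq_0_iff[OF ordering_in_pverts[OF bij, of 0]]
      prod_level_eq_0_iff[OF ordering_in_pverts[OF bij, of "?p - 1"]] assms(2) by simp_all
  then have "z 0 = z (?p - 1)" using assms(1) by (metis card_1_singletonE singletonD)
  moreover have "inj_on z {..<?p}" using bij by (simp add: bij_betw_def)
  ultimately have "0 = ?p - 1" using assms(2) by (auto dest: inj_onD)
  then show False using assms(2) by simp
qed

text \<open>The unit in \<open>min_slack\<close> comes from the end levels with one center, and with
  four centers from the unavoidable change of parity class.\<close>

lemma min_slack_le:
  assumes p: "card (pverts (cart_prod T1 T2)) \<ge> 2"
    and bij: "bij_betw z {..<card (pverts (cart_prod T1 T2))} (pverts (cart_prod T1 T2))"
  shows "min_slack \<le> slack z"
proof (cases rule: center_count_cases)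
  case one
  then have "min_slack = 1" by (simp add: min_slack_def)
  then show ?thesis using one_center_end_levels[OF one(4) p bij] unfolding slack_def by linarith
next
  case two
  then show ?thesis by (simp add: min_slack_def)
next
  case four
  then have "min_slack = 1" by (simp add: min_slack_def)
  then show ?thesis using excess_sum_pos[OF four(1,2) bij] unfolding slack_def by linarith
qed

text \<open>When \<open>min_slack\<close> is 1, one of the two parts of the slack is already known
  to be positive. So minimality forces end levels and total excess to be 1 and 0 with one center, 0
  and 0 with two, 0 and 1 with four.\<close>

lemma slack_eq_min_iff:
  assumes p: "card (pverts (cart_prod T1 T2)) \<ge> 2"
    and bij: "bij_betw z {..<card (pverts (cart_prod T1 T2))} (pverts (cart_prod T1 T2))"
  shows "slack z = min_slack \<longleftrightarrow> feasible_ordering T1 T2 z \<and>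
    (card (weight_centers (cart_prod T1 T2)) = 1 \<longrightarrow>
       prod_level T1 T2 (z 0) + prod_level T1 T2 (z (card (pverts (cart_prod T1 T2)) - 1)) = 1) \<and>
    (card (weight_centers (cart_prod T1 T2)) \<ge> 2 \<longrightarrow>
       prod_level T1 T2 (z 0) + prod_level T1 T2 (z (card (pverts (cart_prod T1 T2)) - 1)) = 0)"
proof -
  let ?p = "card (pverts (cart_prod T1 T2))"
  define L where "L = prod_level T1 T2 (z 0) + prod_level T1 T2 (z (?p - 1))"
  define E where "E = (\<Sum>t<?p - 1. excess z t)"
  have slack: "slack z = L + E" by (simp add: slack_def L_def E_def)
  have feas: "feasible_ordering T1 T2 z \<longleftrightarrow> E = 0"
    if "card (weight_centers (cart_prod T1 T2)) \<noteq> 4"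
    using bij that by (auto simp: E_def feasible_ordering_def Let_def excess_eq_0_iff less_diff_conv)
  show ?thesis
  proof (cases rule: center_count_cases)
    case one
    then show ?thesis using one_center_end_levels[OF one(4) p bij] feas
      by (auto simp: slack min_slack_def L_def)
  next
    case two
    then show ?thesis using feas by (auto simp: slack min_slack_def L_def)
  next
    case four
    \<comment> \<open>phi enters the excess with factor 2, so an excess of 1 can only come from
      delta.\<close>
    have one: "excess z t = 1 \<longleftrightarrow>
        prod_phi T1 T2 (z t) (z (t + 1)) = 0 \<and> prod_delta T1 T2 (z t) (z (t + 1)) = 1" for t
      using prod_delta_le_xi[of "z t" "z (t + 1)"] four(3) unfolding excess_def by arith
    \<comment> \<open>Having at least two vertices makes the middle index an actual step.\<close>
    have mid: "?p div 2 - 1 < ?p - 1" using p by linarith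
    have F: "feasible_ordering T1 T2 z \<longleftrightarrow>
      (\<forall>t<?p - 1. if t = ?p div 2 - 1 then excess z t = 1 else excess z t = 0)"
      unfolding feasible_ordering_def Let_def one excess_eq_0_iff less_diff_conv using bij four by simp
    have "feasible_ordering T1 T2 z \<longleftrightarrow> E = 1"
    proof
      assume "feasible_ordering T1 T2 z"
      then have H: "if t = ?p div 2 - 1 then excess z t = 1 else excess z t = 0" if "t < ?p - 1" for t
        using F that by blast
      have "excess z (?p div 2 - 1) = 1" using H[OF mid] by simp
      moreover have "excess z t = 0" if "t \<in> {..<?p - 1}" "?p div 2 - 1 \<noteq> t" for t
        using H[of t] that by simp
      ultimately show "E = 1"
        unfolding E_def using mid sum_eq_1_iff[of "{..<?p - 1}" "excess z"] by blast
    next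
      assume "E = 1"
      \<comment> \<open>A sum of naturals equal to 1 has a single nonzero term, and
        \<open>switch_in_middle\<close> locates it.\<close>
      then obtain s where s: "s < ?p - 1" "excess z s = 1"
        and rest: "\<And>t. t < ?p - 1 \<Longrightarrow> t \<noteq> s \<Longrightarrow> excess z t = 0"
        unfolding E_def using sum_eq_1_iff[of "{..<?p - 1}" "excess z"] by auto
      have "s = ?p div 2 - 1"
        by (rule switch_in_middle[OF four(1,2) bij])
          (use s rest one excess_eq_0_iff four in \<open>auto simp: feasible_pair_def\<close>)
      then show "feasible_ordering T1 T2 z" using F s rest by auto
    qed
    then show ?thesis using four excess_sum_pos[OF four(1,2) bij, folded E_def]
      by (auto simp: slack min_slack_def L_def)
  qed
qed

text \<open>phi is 0 at every step of a feasible ordering, the exceptional middle one included, so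
  each step distance is exactly the two levels plus delta.\<close>

lemma sum_step_gap_feasible:
  assumes bij: "bij_betw z {..<card (pverts (cart_prod T1 T2))} (pverts (cart_prod T1 T2))"
    and feas: "feasible_ordering T1 T2 z"
    and ab: "a < b" "b \<le> card (pverts (cart_prod T1 T2)) - 1"
  shows "(\<Sum>t = a..<b. P.step_gap z t) = (int b - int a) * (int (diam (cart_prod T1 T2)) + 1) -
    (\<Sum>t = a..<b. int (prod_level T1 T2 (z t) + prod_level T1 T2 (z (t + 1))
                + prod_delta T1 T2 (z t) (z (t + 1))))"
proof -
  have gap: "P.step_gap z t = (int (diam (cart_prod T1 T2)) + 1) -
      int (prod_level T1 T2 (z t) + prod_level T1 T2 (z (t + 1)) + prod_delta T1 T2 (z t) (z (t + 1)))"
    if "t \<in> {a..<b}" for t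
  proof -
    have t: "t + 1 < card (pverts (cart_prod T1 T2))" using that ab by auto
    then have "if card (weight_centers (cart_prod T1 T2)) = 4 \<and> t = card (pverts (cart_prod T1 T2)) div 2 - 1
      then prod_phi T1 T2 (z t) (z (t + 1)) = 0 \<and> prod_delta T1 T2 (z t) (z (t + 1)) = 1
      else feasible_pair T1 T2 (z t) (z (t + 1))"
      using feas unfolding feasible_ordering_def Let_def by blast
    then have "prod_phi T1 T2 (z t) (z (t + 1)) = 0"
      by (simp add: feasible_pair_def split: if_splits)
    moreover have "z t \<in> pverts (cart_prod T1 T2)" "z (t + 1) \<in> pverts (cart_prod T1 T2)"
      using ordering_in_pverts[OF bij] t by auto
    ultimately show ?thesis using prod_gdist_formula[of "z t" "z (t + 1)"]
      by (simp add: P.step_gap_def)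
  qed
  have "(\<Sum>t = a..<b. P.step_gap z t) = (\<Sum>t = a..<b. (int (diam (cart_prod T1 T2)) + 1) -
      int (prod_level T1 T2 (z t) + prod_level T1 T2 (z (t + 1)) + prod_delta T1 T2 (z t) (z (t + 1))))"
    by (rule sum.cong) (use gap in auto)
  then show ?thesis using ab by (simp add: sum_subtractf of_nat_diff del: of_nat_add)
qed

lemma radio_number_single_vertex:
  assumes "card (pverts (cart_prod T1 T2)) = 1"
  shows "radio_number (cart_prod T1 T2) = 0"
proof -
  obtain f where f: "label_span (cart_prod T1 T2) f = radio_number (cart_prod T1 T2)"
    using P.radio_number_attained by blast
  obtain v where "pverts (cart_prod T1 T2) = {v}" using assms card_1_singletonE by blast
  with f show ?thesis by (simp add: label_span_def)
qed

text \<open>This is \<open>radio_number_eq_iff\<close> with \<open>B\<close> the tour length of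
  slack \<open>min_slack\<close>. Attaining that slack encodes feasibility and the end levels, and
  the remaining radio conditions become condition (b).\<close>

lemma radio_number_cart_prod_iff:
  assumes p: "card (pverts (cart_prod T1 T2)) \<ge> 2"
  shows "int (radio_number (cart_prod T1 T2)) =
      (int (card (pverts (cart_prod T1 T2))) - 1) * (int (diam (cart_prod T1 T2)) + 1 - int (xi T1 T2))
      - 2 * int (\<Sum>v\<in>pverts (cart_prod T1 T2). prod_level T1 T2 v) + int min_slack \<longleftrightarrow>
    (\<exists>z. feasible_ordering T1 T2 z \<and>
      (card (weight_centers (cart_prod T1 T2)) = 1 \<longrightarrow>
         prod_level T1 T2 (z 0) + prod_level T1 T2 (z (card (pverts (cart_prod T1 T2)) - 1)) = 1) \<and>
      (card (weight_centers (cart_prod T1 T2)) \<ge> 2 \<longrightarrow>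
         prod_level T1 T2 (z 0) + prod_level T1 T2 (z (card (pverts (cart_prod T1 T2)) - 1)) = 0) \<and>
      (\<forall>a b. a < b \<and> b \<le> card (pverts (cart_prod T1 T2)) - 1 \<longrightarrow>
         int (gdist (cart_prod T1 T2) (z a) (z b)) \<ge>
           (\<Sum>t = a..<b. int (prod_level T1 T2 (z t) + prod_level T1 T2 (z (t + 1))
              + prod_delta T1 T2 (z t) (z (t + 1))))
           - (int b - int a - 1) * (int (diam (cart_prod T1 T2)) + 1)))"
    (is "int _ = ?B \<longleftrightarrow> (\<exists>z. ?feas z \<and> ?one z \<and> ?many z \<and> ?cond z)")
proof -
  let ?V = "pverts (cart_prod T1 T2)"
  let ?bij = "\<lambda>z. bij_betw z {..<card ?V} ?V"
  let ?cond' = "\<lambda>z. \<forall>a b. a < b \<and> b \<le> card ?V - 1 \<longrightarrow>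
        int (diam (cart_prod T1 T2)) + 1 - int (gdist (cart_prod T1 T2) (z a) (z b))
          \<le> (\<Sum>t = a..<b. P.step_gap z t)"
  have tour: "P.tour z = ?B \<longleftrightarrow> slack z = min_slack" if "?bij z" for z
    unfolding tour_eq_slack[OF that] by simp
  have "?B \<le> P.tour z" if "?bij z" for z
    unfolding tour_eq_slack[OF that] using min_slack_le[OF p that] by simp
  from P.radio_number_eq_iff[of ?B, OF this]
  have "int (radio_number (cart_prod T1 T2)) = ?B \<longleftrightarrow> (\<exists>z. ?bij z \<and> P.tour z = ?B \<and> ?cond' z)" by blast
  also have "\<dots> \<longleftrightarrow> (\<exists>z. ?feas z \<and> ?one z \<and> ?many z \<and> ?cond z)"
  proof (rule ex_cong1)
    fix z
    \<comment> \<open>The phi terms vanish only under feasibility, so the two conditions are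
      compared under that assumption. Moving one \<open>diam + 1\<close> to the other side turns the
      factor \<open>b - a\<close> into \<open>b - a - 1\<close>.\<close>
    have cond: "?cond' z \<longleftrightarrow> ?cond z" if z: "?bij z" "?feas z"
    proof -
      have "int (diam (cart_prod T1 T2)) + 1 - int (gdist (cart_prod T1 T2) (z a) (z b))
            \<le> (\<Sum>t = a..<b. P.step_gap z t) \<longleftrightarrow>
          int (gdist (cart_prod T1 T2) (z a) (z b)) \<ge>
           (\<Sum>t = a..<b. int (prod_level T1 T2 (z t) + prod_level T1 T2 (z (t + 1))
              + prod_delta T1 T2 (z t) (z (t + 1))))
           - (int b - int a - 1) * (int (diam (cart_prod T1 T2)) + 1)"
        if "a < b" "b \<le> card ?V - 1" for a b
        unfolding sum_step_gap_feasible[OF z that] by (simp add: algebra_simps)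
      then show ?thesis by blast
    qed
    have "?feas z \<Longrightarrow> ?bij z" by (simp add: feasible_ordering_def Let_def)
    then show "(?bij z \<and> P.tour z = ?B \<and> ?cond' z) \<longleftrightarrow> (?feas z \<and> ?one z \<and> ?many z \<and> ?cond z)"
      using tour[of z] slack_eq_min_iff[OF p, of z] cond by blast
  qed
  finally show ?thesis .
qed

end

theorem theorem3p3:
  fixes T1 :: "'a pair_pre_digraph" and T2 :: "'b pair_pre_digraph"
    and G :: "('a \<times> 'b) pair_pre_digraph"
    and m n d1 d2 p d :: nat
  assumes "undirected_tree T1" and "undirected_tree T2"
    and "m = card (pverts T1)" and "n = card (pverts T2)"
    and "d1 = diam T1" and "d2 = diam T2"
    and "G = cart_prod T1 T2" and "p = m * n" and "d = d1 + d2"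
  shows
    "int (radio_number G) =
       (if card (weight_centers T1) = 1 \<and> card (weight_centers T2) = 1
        then (int p - 1) * (int d + 1)
               - 2 * int n * int (total_level T1) - 2 * int m * int (total_level T2) + 1
        else if card (weight_centers T1) * card (weight_centers T2) = 2
        then (int p - 1) * int d
               - 2 * int n * int (total_level T1) - 2 * int m * int (total_level T2)
        else (int p - 1) * (int d - 1)
               - 2 * int n * int (total_level T1) - 2 * int m * int (total_level T2) + 1)
     \<longleftrightarrow>
     (\<exists>z. feasible_ordering T1 T2 z \<and>
        (card (weight_centers G) = 1 \<longrightarrow>
           prod_level T1 T2 (z 0) + prod_level T1 T2 (z (p - 1)) = 1) \<and>
        (card (weight_centers G) \<ge> 2 \<longrightarrow>
           prod_level T1 T2 (z 0) + prod_level T1 T2 (z (p - 1)) = 0) \<and>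
        (\<forall>a b. a < b \<and> b \<le> p - 1 \<longrightarrow>
           int (gdist G (z a) (z b)) \<ge>
             (\<Sum>t = a..<b. int (prod_level T1 T2 (z t) + prod_level T1 T2 (z (t + 1))
                + prod_delta T1 T2 (z t) (z (t + 1))))
             - (int b - int a - 1) * (int d + 1)))"
proof -
  interpret tree_graph_pair T1 T2
    using assms(1,2) by (intro tree_graph_pair.intro tree_graphI)
  have p: "card (pverts G) = p" and d: "diam G = d"
    using assms diam_cart_prod by (simp_all add: cart_prod_simps(1) card_cartesian_product)
  have L: "(\<Sum>v\<in>pverts G. prod_level T1 T2 v) = n * total_level T1 + m * total_level T2"
    using assms sum_prod_level by simp
  \<comment> \<open>The three cases are one expression, with \<open>xi\<close> equal to 0, 1, 2 and
    \<open>min_slack\<close> equal to 1, 0, 1.\<close>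
  have formula: "(if card (weight_centers T1) = 1 \<and> card (weight_centers T2) = 1
        then (int p - 1) * (int d + 1)
               - 2 * int n * int (total_level T1) - 2 * int m * int (total_level T2) + 1
        else if card (weight_centers T1) * card (weight_centers T2) = 2
        then (int p - 1) * int d
               - 2 * int n * int (total_level T1) - 2 * int m * int (total_level T2)
        else (int p - 1) * (int d - 1)
               - 2 * int n * int (total_level T1) - 2 * int m * int (total_level T2) + 1)
    = (int p - 1) * (int d + 1 - int (xi T1 T2))
        - 2 * int (n * total_level T1 + m * total_level T2) + int min_slack"
  proof (cases rule: center_count_cases)
    case two
    then have neq: "\<not> (card (weight_centers T1) = 1 \<and> card (weight_centers T2) = 1)" by auto
    show ?thesis
      unfolding if_not_P[OF neq] if_P[OF two(1)] using two(2)
      by (simp add: min_slack_def algebra_simps)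
  qed (simp_all add: min_slack_def algebra_simps)
  show ?thesis
  proof (cases "p = 1")
    \<comment> \<open>For a single vertex both sides are false. The radio number is 0 but the
      formula is odd; the two ends coincide, so their levels add up to an even number instead of
      1.\<close>
    case True
    then have "m = 1" "n = 1" using assms(8) by simp_all
    then have "card (weight_centers T1) \<le> 1" "card (weight_centers T2) \<le> 1"
      using card_mono[OF T1.finite_verts T1.weight_centers_subset]
        card_mono[OF T2.finite_verts T2.weight_centers_subset] assms by simp_all
    moreover have "card (weight_centers T1) = 1 \<or> card (weight_centers T1) = 2"
      "card (weight_centers T2) = 1 \<or> card (weight_centers T2) = 2"
      by (rule T1.card_weight_centers T2.card_weight_centers)+
    ultimately have "card (weight_centers T1) = 1" "card (weight_centers T2) = 1" by linarith+
    then have one: "card (weight_centers G) = 1" "xi T1 T2 = 0"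
      by (simp_all add: assms(7) weight_centers_cart_prod card_cartesian_product xi_def)
    have "radio_number G = 0" using radio_number_single_vertex p True assms(7) by simp
    moreover have "0 \<noteq> (int p - 1) * (int d + 1 - int (xi T1 T2))
        - 2 * int (n * total_level T1 + m * total_level T2) + int min_slack"
      using True one by (simp add: min_slack_def) presburger
    moreover have "x + x \<noteq> 1" for x :: nat by presburger
    ultimately show ?thesis unfolding formula using True one by simp
  next
    case False
    then have "card (pverts (cart_prod T1 T2)) \<ge> 2"
      using P.card_pverts_pos p unfolding assms(7) by linarith
    from radio_number_cart_prod_iff[OF this]
    show ?thesis unfolding formula assms(7)[symmetric] p d L .
  qed
qed

end
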